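(* Let $d\in\mathbb{N}$ and let $\mu$ be a Borel probability measure supported on a subset $E$ of $[0,1)^{d}$. Let $(A_n)_{n\in\mathbb{N}}$ be a sequence of expanding integral $d\times d$ matrices. Assume that there is a constant $K>1$ such that $\sigma(A_{n+1}A_n^{-1})\ge K$ for all $n\in\mathbb{N}$, and that there exists $s>d+1$ such that $$\widehat{\mu}(\mathbf{t})=O\big((\log|\mathbf{t}|_{\infty})^{-s}\big)\quad\text{as }|\mathbf{t}|_{\infty}\to\infty.$$ Let $\mathbf{y}\in[0,1)^d$ and let $r_1,\ldots,r_d:\mathbb{N}\to(0,\tfrac12)$ be functions. For $\mathbf{x}\in[0,1)^d$ and $N\in\mathbb{N}$ put $$R(\mathbf{x},N)=\#\{1\le n\le N: A_n\mathbf{x}\in\mathbf{y}+\mathcal{R}_n\ (\mathrm{mod}\ 1)\},\qquad \Psi(N)=\sum_{n=1}^{N}2^{d}r_1(n)\cdots r_d(n).$$ Then for any $\varepsilon>0$, $$R(\mathbf{x},N)=\Psi(N)+O\Big(\Psi(N)^{\frac{d}{d+1}}\big(\log(\Psi(N)+2)\big)^{2+\varepsilon}\Big)\qquad (N\in\mathbb{N})$$ for $\mu$-almost all $\mathbf{x}\in E$, where the implied constant does not depend on $N$ (it may depend on $\mathbf{x}$, $\varepsilon$ and the other fixed data).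
   Context: For $\mathbf{t}\in\mathbb{R}^d$, $|\mathbf{t}|_\infty=\max_{1\le i\le d}|t_i|$, and $\widehat{\mu}(\mathbf{t})=\int e^{-2\pi i\langle \mathbf{t},\mathbf{x}\rangle}\,d\mu(\mathbf{x})$, where $\langle\mathbf{t},\mathbf{x}\rangle=t_1x_1+\cdots+t_dx_d$. "$\mu$ supported on $E$" means $\mathrm{supp}(\mu)\subset E$. For a real $d\times d$ matrix $A$, $\sigma(A)=\inf\{\|A\mathbf{x}\|_2:\|\mathbf{x}\|_2=1\}$ denotes its smallest singular value. An expanding integral matrix is a $d\times d$ matrix with integer entries all of whose (complex) eigenvalues have modulus $>1$. For $\alpha\in\mathbb{R}$, $\|\alpha\|=\min\{|\alpha-m|:m\in\mathbb{Z}\}$. For $n\in\mathbb{N}$, $$\mathcal{R}_n=\{\mathbf{x}\in[0,1)^d:\|x_i\|\le r_i(n),\ 1\le i\le d\}.$$ Thus $A_n\mathbf{x}\in\mathbf{y}+\mathcal{R}_n\ (\mathrm{mod}\ 1)$ means that $\|(A_n\mathbf{x})_i-y_i\|\le r_i(n)$ for all $1\le i\le d$. *)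

theory Defs
  imports "HOL-Probability.Probability" "HOL-Library.Landau_Symbols"
begin

(* The dimension d is CARD('d); vectors are real^'d and matrices are real^'d^'d. *)

definition unit_cube :: "(real^'d) set" where
  "unit_cube = {x. \<forall>i. 0 \<le> x $ i \<and> x $ i < 1}"

definition msupport :: "'a::topological_space measure \<Rightarrow> 'a set" where
  "msupport M = {x. \<forall>U. open U \<longrightarrow> x \<in> U \<longrightarrow> emeasure M U > 0}"

definition fourier :: "(real^'d) measure \<Rightarrow> real^'d \<Rightarrow> complex" where
  "fourier M t = (CLINT x|M. exp (- 2 * complex_of_real pi * \<i> * complex_of_real (t \<bullet> x)))"

(* norm is the Euclidean norm on real^'d. *)
definition smallest_singular_value :: "real^'d^'d \<Rightarrow> real" where
  "smallest_singular_value B = Inf {norm (B *v x) |x. norm x = 1}"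

definition complex_eigenvalue :: "real^'d^'d \<Rightarrow> complex \<Rightarrow> bool" where
  "complex_eigenvalue B c \<longleftrightarrow>
     (\<exists>v :: complex^'d. v \<noteq> 0 \<and> map_matrix complex_of_real B *v v = c *s v)"

definition expanding_integral :: "real^'d^'d \<Rightarrow> bool" where
  "expanding_integral B \<longleftrightarrow>
     (\<forall>i j. B $ i $ j \<in> \<int>) \<and> (\<forall>c. complex_eigenvalue B c \<longrightarrow> norm c > 1)"

definition dist_int :: "real \<Rightarrow> real" where
  "dist_int a = (INF m::int. \<bar>a - of_int m\<bar>)"

lemma dist_int_eq_round: "dist_int a = \<bar>a - of_int (round a)\<bar>"
  unfolding dist_int_def
  by (intro cInf_eq_minimum) (auto intro: round_diff_minimal)

lemma dist_int_le: "dist_int a \<le> \<bar>a - of_int m\<bar>"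
  by (simp add: dist_int_eq_round round_diff_minimal)

lemma dist_int_cong:
  assumes "a - b \<in> \<int>"
  shows "dist_int a = dist_int b"
proof -
  obtain k :: int where k: "a = b + of_int k"
    using assms by (metis Ints_cases add.commute diff_add_cancel)
  have "dist_int a \<le> dist_int b"
    using dist_int_le[of a "round b + k"] by (simp add: k dist_int_eq_round[of b])
  moreover have "dist_int b \<le> dist_int a"
    using dist_int_le[of b "round a - k"] by (simp add: k dist_int_eq_round[of "b + of_int k"])
  ultimately show ?thesis by simp
qed

(* The sets R_n, with r i n standing for r_i(n). *)
definition target_box :: "('d \<Rightarrow> nat \<Rightarrow> real) \<Rightarrow> nat \<Rightarrow> (real^'d) set" where
  "target_box r n = {x \<in> unit_cube. \<forall>i. dist_int (x $ i) \<le> r i n}"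

(* v belongs to S modulo 1, i.e. v lies in S + Z^d. *)
definition mem_mod1 :: "real^'d \<Rightarrow> (real^'d) set \<Rightarrow> bool" where
  "mem_mod1 v S \<longleftrightarrow> (\<exists>z\<in>S. \<forall>i. v $ i - z $ i \<in> \<int>)"

lemma mem_mod1_target_box_iff:
  "mem_mod1 v ((+) y ` target_box r n) \<longleftrightarrow> (\<forall>i. dist_int (v $ i - y $ i) \<le> r i n)"
proof
  assume "mem_mod1 v ((+) y ` target_box r n)"
  then obtain z where z: "z \<in> target_box r n" "\<forall>i. v $ i - (y + z) $ i \<in> \<int>"
    by (auto simp: mem_mod1_def)
  have "dist_int (v $ i - y $ i) = dist_int (z $ i)" for i
    using z(2) by (intro dist_int_cong) (simp add: diff_diff_eq)
  then show "\<forall>i. dist_int (v $ i - y $ i) \<le> r i n"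
    using z(1) by (simp add: target_box_def)
next
  assume *: "\<forall>i. dist_int (v $ i - y $ i) \<le> r i n"
  define z :: "real^'a" where "z = (\<chi> i. frac (v $ i - y $ i))"
  have eq: "v $ i - y $ i - z $ i = of_int \<lfloor>v $ i - y $ i\<rfloor>" for i
    by (simp add: z_def frac_def)
  have "dist_int (z $ i) = dist_int (v $ i - y $ i)" for i
    by (rule dist_int_cong[symmetric]) (simp only: eq Ints_of_int)
  moreover have "z \<in> unit_cube"
    by (simp add: unit_cube_def z_def frac_lt_1)
  ultimately have "z \<in> target_box r n"
    using * by (simp add: target_box_def)
  moreover have "v $ i - (y + z) $ i \<in> \<int>" for i
    using eq[of i] by (simp add: diff_diff_eq[symmetric])
  ultimately show "mem_mod1 v ((+) y ` target_box r n)"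
    unfolding mem_mod1_def by blast
qed

definition hit_count ::
  "(nat \<Rightarrow> real^'d^'d) \<Rightarrow> real^'d \<Rightarrow> ('d \<Rightarrow> nat \<Rightarrow> real) \<Rightarrow> real^'d \<Rightarrow> nat \<Rightarrow> nat" where
  "hit_count A y r x N = card {n \<in> {1..N}. mem_mod1 (A n *v x) ((+) y ` target_box r n)}"

definition Psi :: "('d::finite \<Rightarrow> nat \<Rightarrow> real) \<Rightarrow> nat \<Rightarrow> real" where
  "Psi r N = (\<Sum>n=1..N. 2 ^ CARD('d) * (\<Prod>i\<in>UNIV. r i n))"

end

theory Submission
  imports Defs "HOL-Real_Asymp.Real_Asymp"
begin

text \<open>
  The count \<open>hit_count A y r x N\<close> is a sum of indicators of the events
  \<open>E n = hit_set (A n) y (\<lambda>i. r i n)\<close>, and the theorem is a law of large numbers for it: it suffices to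
  show that the events are nearly independent in pairs, so that the variance of the count over a
  block of indices is at most a constant times the expected count of the block
  (\<open>variance_bound_of_quasi_independence\<close>), and to conclude with a second-moment criterion in
  the style of Gal and Koksma, run in the clock \<open>Psi r N\<close> and not in \<open>N\<close>
  (\<open>strong_law_of_variance_bound\<close>). This gives a square-root error up to logarithms, and
  \<open>1 / 2 \<le> d / (d + 1)\<close>.

  Near-independence comes from Fourier analysis. The indicator of a target is majorised by a
  trigonometric polynomial with small excess, the sum of whose coefficients is at most a power of
  the logarithm of the degree (\<open>box_majorant\<close>). Integrated against the measure, a product of two characters at
  \<open>A m x\<close> and \<open>A n x\<close>, with \<open>m < n\<close>, becomes a value of the Fourier transform at
  the frequency \<open>k v* A m + l v* A n\<close>. If \<open>l \<noteq> 0\<close> and \<open>k\<close> is small compared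
  with \<open>K ^ (n - m)\<close>, lacunarity makes that frequency exponentially large in \<open>n\<close>
  (\<open>frequency_growth\<close>), hence the value is \<open>O(n powr (- s))\<close>, and \<open>s > d + 1 \<ge> 2\<close>
  leaves room to sum over all pairs. Only the main term remains.

  The delicate point is that close pairs must be controlled by \<open>Psi r N\<close>, which may grow much
  more slowly than \<open>log N\<close>. A fixed accuracy for all pairs would exclude the pairs with
  \<open>n - m\<close> below a multiple of \<open>log n\<close> and lose a factor \<open>log N\<close>. Instead the degree of
  the majorant for the earlier target grows with \<open>n - m\<close>, while that for the later target is
  unrestricted. The excess of the former is then
  \<open>O(1 / (n - m)\<^sup>2)\<close>, and it is multiplied by the measure of the later target, so the sum
  over \<open>m\<close> costs only a constant (\<open>measure_hit_set_asymptotics\<close>).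

  Lower bounds for the measures of the targets need no minorants: they follow from the upper
  bounds, applied to the other cells of a partition into boxes (\<open>hit_set_lower_bound\<close>).
\<close>

section \<open>The Fejer kernel and majorants of arcs\<close>

definition fejer :: "nat \<Rightarrow> real \<Rightarrow> real" where
  "fejer N u = (\<Sum>a<N. \<Sum>b<N. cos (2 * pi * (real a - real b) * u)) / N"

text \<open>The antiderivative of \<open>fejer N\<close>, taken term by term; the diagonal terms are the
  constant ones. Both are kept as double sums, which makes positivity visible; equal frequencies
  are collected only in the final majorant.\<close>
definition fejer_primitive :: "nat \<Rightarrow> real \<Rightarrow> real" where
  "fejer_primitive N u = (\<Sum>a<N. \<Sum>b<N.
     if a = b then u
     else sin (2 * pi * (real a - real b) * u) / (2 * pi * (real a - real b))) / N"

lemma fejer_eq_norm_square: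
  "fejer N u = (norm (\<Sum>a<N. cis (2 * pi * real a * u)))\<^sup>2 / N"
proof -
  have "(norm (\<Sum>a<N. cis (2 * pi * real a * u)))\<^sup>2 =
        (\<Sum>a<N. cos (2 * pi * real a * u))\<^sup>2 + (\<Sum>a<N. sin (2 * pi * real a * u))\<^sup>2"
    by (simp add: cmod_power2)
  also have "\<dots> = (\<Sum>a<N. \<Sum>b<N. cos (2 * pi * real a * u) * cos (2 * pi * real b * u)
      + sin (2 * pi * real a * u) * sin (2 * pi * real b * u))"
    by (simp add: power2_eq_square sum_product sum.distrib)
  also have "\<dots> = (\<Sum>a<N. \<Sum>b<N. cos (2 * pi * (real a - real b) * u))"
    by (intro sum.cong refl) (simp add: cos_diff[symmetric] algebra_simps)
  finally show ?thesis by (simp add: fejer_def)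
qed

lemma fejer_nonneg: "fejer N u \<ge> 0"
  by (simp add: fejer_eq_norm_square)

lemma sin_pi_ge:
  assumes "0 \<le> u" "u \<le> 1 / 2"
  shows "sin (pi * u) \<ge> u"
proof (cases "u \<le> 1 / 3")
  case True
  have "(\<lambda>u. sin (pi * u) - u) 0 \<le> (\<lambda>u. sin (pi * u) - u) u"
  proof (rule DERIV_nonneg_imp_nondecreasing[OF assms(1)])
    fix v :: real assume v: "0 \<le> v" "v \<le> u"
    have "pi * v \<le> pi * (1 / 3)" using v True by (intro mult_left_mono) auto
    then have "cos (pi / 3) \<le> cos (pi * v)"
      using v by (intro cos_monotone_0_pi_le) auto
    then have "1 \<le> pi * cos (pi * v)"
      using pi_gt3 mult_mono[of 2 pi "1 / 2" "cos (pi * v)"] by (simp add: cos_60)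
    moreover have "((\<lambda>u. sin (pi * u) - u) has_real_derivative pi * cos (pi * v) - 1) (at v)"
      by (auto intro!: derivative_eq_intros)
    ultimately show "\<exists>y. ((\<lambda>u. sin (pi * u) - u) has_real_derivative y) (at v) \<and> 0 \<le> y"
      by (intro exI[of _ "pi * cos (pi * v) - 1"]) simp
  qed
  then show ?thesis by simp
next
  case False
  then have "pi * (1 / 3) \<le> pi * u" by (intro mult_left_mono) auto
  moreover have "pi * u \<le> pi * (1 / 2)" using assms by (intro mult_left_mono) auto
  ultimately have "sin (pi / 6) \<le> sin (pi * u)"
    by (intro sin_monotone_2pi_le) auto
  then show ?thesis using assms by (simp add: sin_30)
qed

text \<open>The kernel is the squared modulus of a geometric sum with ratio \<open>z = cis (2 * pi * u)\<close>,
  divided by \<open>N\<close>, and that sum is at most \<open>2 / norm (1 - z) = 1 / sin (pi * u)\<close>.\<close>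
lemma fejer_le:
  assumes "\<delta> > 0" "\<delta> \<le> u" "u \<le> 1 - \<delta>" "N > 0"
  shows "fejer N u \<le> 1 / (real N * \<delta>\<^sup>2)"
proof -
  define z where "z = cis (2 * pi * u)"
  have s: "sin (pi * u) \<ge> \<delta>"
  proof (cases "u \<le> 1 / 2")
    case True
    then show ?thesis using sin_pi_ge[of u] assms by simp
  next
    case False
    have "sin (pi * u) = sin (pi * (1 - u))" by (simp add: right_diff_distrib)
    then show ?thesis using sin_pi_ge[of "1 - u"] assms False by simp
  qed
  have "(norm (1 - z))\<^sup>2 = (1 - cos (2 * (pi * u)))\<^sup>2 + (sin (2 * (pi * u)))\<^sup>2"
    by (simp add: z_def cmod_power2 mult.assoc)
  also have "\<dots> = 4 * (sin (pi * u))\<^sup>2 * ((sin (pi * u))\<^sup>2 + (cos (pi * u))\<^sup>2)"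
  proof -
    have "(1 - (1 - 2 * s\<^sup>2))\<^sup>2 + (2 * s * c)\<^sup>2 = 4 * s\<^sup>2 * (s\<^sup>2 + c\<^sup>2)" for s c :: real
      by (simp add: power2_eq_square algebra_simps)
    then show ?thesis by (simp only: cos_double_sin sin_double)
  qed
  finally have "(norm (1 - z))\<^sup>2 = (2 * sin (pi * u))\<^sup>2" by (simp add: power_mult_distrib)
  then have norm1: "norm (1 - z) = 2 * sin (pi * u)"
    by (rule power2_eq_imp_eq) (use s assms in simp_all)
  then have z1: "z \<noteq> 1" using s assms by auto
  have "(\<Sum>a<N. cis (2 * pi * real a * u)) = (\<Sum>a<N. z ^ a)"
    by (intro sum.cong refl) (simp add: z_def Complex.DeMoivre ac_simps)
  also have "\<dots> = (1 - z ^ N) / (1 - z)" using z1 by (simp add: sum_gp_strict)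
  finally have "norm (\<Sum>a<N. cis (2 * pi * real a * u)) = norm (1 - z ^ N) / (2 * sin (pi * u))"
    by (simp add: norm_divide norm1)
  also have "\<dots> \<le> 2 / (2 * \<delta>)"
  proof (rule frac_le)
    have "norm (1 - z ^ N) \<le> norm (1::complex) + norm (z ^ N)" by (rule norm_triangle_ineq4)
    then show "norm (1 - z ^ N) \<le> 2" by (simp add: z_def norm_power)
  qed (use s assms in auto)
  finally have "norm (\<Sum>a<N. cis (2 * pi * real a * u)) \<le> 1 / \<delta>" by simp
  then have "(norm (\<Sum>a<N. cis (2 * pi * real a * u)))\<^sup>2 \<le> (1 / \<delta>)\<^sup>2"
    by (intro power_mono) auto
  then have "fejer N u \<le> (1 / \<delta>)\<^sup>2 / N"
    unfolding fejer_eq_norm_square by (intro divide_right_mono) auto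
  then show ?thesis by (simp add: power_one_over mult.commute)
qed

lemma fejer_primitive_has_derivative:
  "(fejer_primitive N has_real_derivative fejer N u) (at u)"
proof -
  have "((\<lambda>u. if a = b then u
     else sin (2 * pi * (real a - real b) * u) / (2 * pi * (real a - real b)))
      has_real_derivative cos (2 * pi * (real a - real b) * u)) (at u)" for a b :: nat
    by (cases "a = b") (auto intro!: derivative_eq_intros)
  then show ?thesis unfolding fejer_primitive_def[abs_def] fejer_def
    by (intro DERIV_cdivide DERIV_sum)
qed

lemma fejer_primitive_mono: "u \<le> v \<Longrightarrow> fejer_primitive N u \<le> fejer_primitive N v"
  by (rule DERIV_nonneg_imp_nondecreasing) (use fejer_primitive_has_derivative fejer_nonneg in blast)+

lemma fejer_primitive_shift:
  assumes "N > 0"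
  shows "fejer_primitive N (u + of_int k) = fejer_primitive N u + of_int k"
proof -
  have "(if a = b then u + of_int k
     else sin (2 * pi * (real a - real b) * (u + of_int k)) / (2 * pi * (real a - real b)))
    = (if a = b then u else sin (2 * pi * (real a - real b) * u) / (2 * pi * (real a - real b)))
      + (if a = b then of_int k else 0)" for a b :: nat
  proof -
    have "sin (2 * pi * (real a - real b) * (u + of_int k)) =
          sin (2 * pi * (real a - real b) * u + 2 * pi * of_int ((int a - int b) * k))"
      by (simp add: algebra_simps)
    also have "\<dots> = sin (2 * pi * (real a - real b) * u)"
      by (simp add: sin_add  flip: of_int_mult of_int_diff)
    finally show ?thesis by simp
  qed
  then show ?thesis using assms
    unfolding fejer_primitive_def by (simp add: sum.distrib add_divide_distrib)
qed

lemma sum_inverse_distance_le: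
  assumes "a < N"
  shows "(\<Sum>b\<in>{..<N} - {a}. 1 / \<bar>real a - real b\<bar>) \<le> 2 * (1 + ln (real N))"
proof -
  have harm_le: "harm N \<le> 1 + ln (real N)"
    using decseq_harm_diff_ln[THEN decseqD, of 0 "N - 1"] assms by (simp add: harm_expand)
  have "(\<Sum>b\<in>{..<N} - {a}. 1 / \<bar>real a - real b\<bar>) =
        (\<Sum>b\<in>{..<a}. 1 / \<bar>real a - real b\<bar>) + (\<Sum>b\<in>{a<..<N}. 1 / \<bar>real a - real b\<bar>)"
    using assms by (subst sum.union_disjoint[symmetric]) (auto intro!: sum.cong)
  also have "(\<Sum>b\<in>{..<a}. 1 / \<bar>real a - real b\<bar>) = (\<Sum>k\<in>{1..a}. inverse (real k))"
    by (rule sum.reindex_bij_witness[of _ "\<lambda>k. a - k" "\<lambda>b. a - b"])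
       (auto simp: of_nat_diff field_simps)
  also have "(\<Sum>b\<in>{a<..<N}. 1 / \<bar>real a - real b\<bar>) = (\<Sum>k\<in>{1..<N - a}. inverse (real k))"
    by (rule sum.reindex_bij_witness[of _ "\<lambda>k. a + k" "\<lambda>b. b - a"])
       (auto simp: of_nat_diff field_simps)
  also have "(\<Sum>k\<in>{1..a}. inverse (real k)) \<le> harm N"
    unfolding harm_def using assms by (intro sum_mono2) auto
  also have "(\<Sum>k\<in>{1..<N - a}. inverse (real k)) \<le> harm N"
    unfolding harm_def using assms by (intro sum_mono2) auto
  finally show ?thesis using harm_le by simp
qed

text \<open>The indicator of an arc of half-length \<open>r\<close> on the circle is majorised by a
  trigonometric polynomial of degree below \<open>M\<^sup>3\<close> whose mean exceeds the length \<open>2 r\<close>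
  by only \<open>3 / M\<close> and whose coefficients sum to \<open>O(log M)\<close>. The polynomial is the
  convolution of the Fejer kernel of order \<open>N = M\<^sup>3\<close> with the arc enlarged by
  \<open>\<delta> = 1 / M\<close> on either side, that is \<open>G (x + R) - G (x - R)\<close> with \<open>G\<close> the
  primitive of the kernel and \<open>R = r + \<delta>\<close>. At a point of the original arc the convolution
  misses at most the mass of the kernel outside \<open>[-\<delta>, \<delta>]\<close>, which is at most
  \<open>\<tau> = 1 / (N \<delta>\<^sup>2) = 1 / M\<close>; adding the constant \<open>\<tau>\<close> repairs this. Exponent 3
  balances \<open>\<delta>\<close> against \<open>\<tau>\<close>. The logarithmic bound on the coefficients comes from
  their decay \<open>1 / \<bar>k\<bar>\<close>; positivity alone would only give a power of \<open>M\<close>.\<close>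
lemma arc_majorant:
  fixes M :: nat and r :: real
  assumes M: "M \<ge> 1" and r: "0 < r" "r < 1 / 2"
  obtains c :: "int \<Rightarrow> real" and g :: "real \<Rightarrow> real" where
    "\<And>x. of_real (g x) = (\<Sum>k\<in>{1 - int M ^ 3..int M ^ 3 - 1}. of_real (c k) * cis (2 * pi * of_int k * x))"
    "\<And>x. g x \<ge> 0"
    "\<And>x. dist_int x \<le> r \<Longrightarrow> g x \<ge> 1"
    "c 0 = 2 * r + 3 / M"
    "(\<Sum>k\<in>{1 - int M ^ 3..int M ^ 3 - 1}. \<bar>c k\<bar>) \<le> 6 + 3 * ln (real M)"
proof -
  define N where "N = M ^ 3"
  define \<delta> where "\<delta> = 1 / real M"
  define R where "R = r + \<delta>"
  define \<tau> where "\<tau> = 1 / real M"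
  define G where "G = fejer_primitive N"
  define I where "I = {..<N} \<times> {..<N}"
  define h where "h = (\<lambda>(a, b). int a - int b)"
  define C where "C = (\<lambda>(a, b). if a = b then (2 * R + \<tau>) / N
     else sin (2 * pi * (real a - real b) * R) / (pi * (real a - real b)) / N)"
  define g where "g x = G (x + R) - G (x - R) + \<tau>" for x
  define c where "c k = (\<Sum>p | p \<in> I \<and> h p = k. C p)" for k
  define J where "J = {1 - int M ^ 3..int M ^ 3 - 1}"
  have N: "N > 0" using M by (simp add: N_def)
  have intN: "int N = int M ^ 3" by (simp add: N_def)
  have finI: "finite I" by (simp add: I_def)
  have hJ: "h ` I \<subseteq> J" by (auto simp: h_def I_def J_def intN[symmetric])
  \<comment> \<open>collecting the terms of the double sum that have the same frequency\<close>
  have regroup: "(\<Sum>k\<in>J. \<Sum>p | p \<in> I \<and> h p = k. F p) = sum F I" for F :: "nat \<times> nat \<Rightarrow> 'b::comm_monoid_add"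
    using finI hJ by (intro sum.group) (auto simp: J_def)
  have "of_real (g x) = (\<Sum>k\<in>J. of_real (c k) * cis (2 * pi * of_int k * x))" for x
  proof -
    let ?w = "\<lambda>p. of_real (C p) * cis (2 * pi * of_int (h p) * x)"
    have "(\<Sum>k\<in>J. of_real (c k) * cis (2 * pi * of_int k * x)) =
          (\<Sum>k\<in>J. \<Sum>p | p \<in> I \<and> h p = k. ?w p)"
      by (auto simp: c_def sum_distrib_right intro!: sum.cong)
    also have "\<dots> = (\<Sum>p\<in>I. ?w p)" by (rule regroup)
    also have "\<dots> = (\<Sum>a<N. \<Sum>b<N. ?w (a, b))"
      by (simp add: I_def sum.cartesian_product)
    also have "\<dots> = of_real (g x)"
    proof (rule complex_eqI)
      have "Re (\<Sum>a<N. \<Sum>b<N. ?w (a, b)) =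
            (\<Sum>a<N. \<Sum>b<N. C (a, b) * cos (2 * pi * (real a - real b) * x))"
        by (simp add: h_def)
      also have "\<dots> = (\<Sum>a<N. \<Sum>b<N.
          ((if a = b then x + R else sin (2 * pi * (real a - real b) * (x + R)) / (2 * pi * (real a - real b)))
          - (if a = b then x - R else sin (2 * pi * (real a - real b) * (x - R)) / (2 * pi * (real a - real b)))
          + (if a = b then \<tau> else 0)) / N)"
      proof (intro sum.cong refl)
        fix a b
        show "C (a, b) * cos (2 * pi * (real a - real b) * x) =
          ((if a = b then x + R else sin (2 * pi * (real a - real b) * (x + R)) / (2 * pi * (real a - real b)))
          - (if a = b then x - R else sin (2 * pi * (real a - real b) * (x - R)) / (2 * pi * (real a - real b)))
          + (if a = b then \<tau> else 0)) / N"
        proof (cases "a = b")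
          case True
          then show ?thesis by (simp add: C_def)
        next
          case False
          define t where "t = 2 * pi * (real a - real b)"
          have t: "pi * (real a - real b) = t / 2" by (simp add: t_def)
          have "sin (t * (x + R)) - sin (t * (x - R)) = 2 * sin (t * R) * cos (t * x)"
            by (simp add: distrib_left right_diff_distrib sin_add sin_diff)
          then have key: "sin (t * R) / (t / 2) * cos (t * x) = sin (t * (x + R)) / t - sin (t * (x - R)) / t"
            by (simp add: diff_divide_distrib[symmetric])
          have "sin (t * R) / (t / 2) / N * cos (t * x) = (sin (t * R) / (t / 2) * cos (t * x)) / N"
            by simp
          also note key
          finally show ?thesis using False
            unfolding C_def prod.case t t_def[symmetric] by (simp only: False if_False add_0_right)
        qed
      qed
      also have "\<dots> = g x"
        using N by (simp add: g_def G_def fejer_primitive_def sum.distrib sum_subtractf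
            add_divide_distrib diff_divide_distrib flip: sum_divide_distrib)
      finally show "Re (\<Sum>a<N. \<Sum>b<N. ?w (a, b)) = Re (of_real (g x))" by simp
    next
      \<comment> \<open>the coefficients are symmetric, so the sines cancel in pairs\<close>
      let ?s = "\<lambda>a b. C (a, b) * sin (2 * pi * (real a - real b) * x)"
      have anti: "?s a b = - ?s b a" for a b
      proof -
        have C: "C (a, b) = C (b, a)"
        proof -
          have eq: "2 * pi * (real b - real a) * R = - (2 * pi * (real a - real b) * R)"
            "pi * (real b - real a) = - (pi * (real a - real b))"
            by (simp_all add: algebra_simps)
          show ?thesis unfolding C_def prod.case eq by simp
        qed
        have "2 * pi * (real a - real b) * x = - (2 * pi * (real b - real a) * x)"
          by (simp add: algebra_simps)
        then show ?thesis by (simp only: C sin_minus mult_minus_right)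
      qed
      have "(\<Sum>a<N. \<Sum>b<N. ?s a b) = (\<Sum>b<N. \<Sum>a<N. ?s a b)" by (rule sum.swap)
      also have "\<dots> = - (\<Sum>b<N. \<Sum>a<N. ?s b a)"
        unfolding sum_negf[symmetric] by (intro sum.cong refl anti)
      finally have "(\<Sum>a<N. \<Sum>b<N. ?s a b) = 0" by simp
      then show "Im (\<Sum>a<N. \<Sum>b<N. ?w (a, b)) = Im (of_real (g x))"
        by (simp add: h_def)
    qed
    finally show ?thesis by simp
  qed
  moreover have "g x \<ge> 0" for x
  proof -
    have "G (x - R) \<le> G (x + R)" unfolding G_def
      using r by (intro fejer_primitive_mono) (simp add: R_def \<delta>_def)
    then show ?thesis by (simp add: g_def \<tau>_def)
  qed
  moreover have "g x \<ge> 1" if x: "dist_int x \<le> r" for x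
  proof -
    define x' where "x' = x - of_int (round x)"
    have x': "\<bar>x'\<bar> \<le> r" using x by (simp add: dist_int_eq_round x'_def)
    have gx: "g x = G (x' + R) - G (x' - R) + \<tau>"
      using fejer_primitive_shift[OF N, of "x' + R" "round x"]
        fejer_primitive_shift[OF N, of "x' - R" "round x"]
      by (simp add: g_def G_def x'_def algebra_simps)
    have shift: "G (x' - R + 1) = G (x' - R) + 1"
      using fejer_primitive_shift[OF N, of "x' - R" 1] by (simp add: G_def)
    show ?thesis
    \<comment> \<open>an enlarged arc that wraps around the circle captures the whole mass of the kernel\<close>
    proof (cases "2 * R < 1")
      case False
      then have "G (x' - R + 1) \<le> G (x' + R)"
        unfolding G_def by (intro fejer_primitive_mono) simp
      moreover have "\<tau> \<ge> 0" by (simp add: \<tau>_def)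
      ultimately show ?thesis using gx shift by linarith
    next
      case True
      have "\<exists>z>x' + R. z < x' - R + 1 \<and>
          G (x' - R + 1) - G (x' + R) = (x' - R + 1 - (x' + R)) * fejer N z"
        unfolding G_def using True fejer_primitive_has_derivative by (intro MVT2) auto
      then obtain z where z: "z > x' + R" "z < x' - R + 1"
        "G (x' - R + 1) - G (x' + R) = (x' - R + 1 - (x' + R)) * fejer N z" by blast
      have "fejer N z \<le> 1 / (real N * \<delta>\<^sup>2)"
        using z x' M N by (intro fejer_le) (auto simp: R_def \<delta>_def)
      also have "\<dots> = \<tau>"
        using M by (simp add: N_def \<delta>_def \<tau>_def power2_eq_square power3_eq_cube)
      finally have "fejer N z \<le> \<tau>" .
      moreover have "R \<ge> 0" using r by (simp add: R_def \<delta>_def)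
      ultimately have "(x' - R + 1 - (x' + R)) * fejer N z \<le> 1 * \<tau>"
        using True by (intro mult_mono) (auto simp: fejer_nonneg)
      then show ?thesis using z(3) gx shift by simp
    qed
  qed
  moreover have "c 0 = 2 * r + 3 / M"
  proof -
    have "{p. p \<in> I \<and> h p = 0} = (\<lambda>a. (a, a)) ` {..<N}"
      by (auto simp: I_def h_def)
    then have "c 0 = (\<Sum>a<N. C (a, a))"
      by (simp add: c_def sum.reindex inj_on_def)
    then show ?thesis using N by (simp add: C_def R_def \<delta>_def \<tau>_def)
  qed
  moreover have "(\<Sum>k\<in>J. \<bar>c k\<bar>) \<le> 6 + 3 * ln (real M)"
  proof -
    have "(\<Sum>k\<in>J. \<bar>c k\<bar>) \<le> (\<Sum>k\<in>J. \<Sum>p | p \<in> I \<and> h p = k. \<bar>C p\<bar>)"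
      unfolding c_def by (intro sum_mono sum_abs)
    also have "\<dots> = (\<Sum>p\<in>I. \<bar>C p\<bar>)" by (rule regroup)
    also have "\<dots> = (\<Sum>a<N. \<Sum>b<N. \<bar>C (a, b)\<bar>)"
      by (simp add: I_def sum.cartesian_product)
    also have "\<dots> \<le> (\<Sum>a<N. (6 + 3 * ln (real M)) / N)"
    proof (intro sum_mono)
      fix a assume "a \<in> {..<N}"
      then have a: "a < N" by simp
      have "(\<Sum>b<N. \<bar>C (a, b)\<bar>) = \<bar>C (a, a)\<bar> + (\<Sum>b\<in>{..<N} - {a}. \<bar>C (a, b)\<bar>)"
        using a by (simp add: sum.remove)
      also have "(\<Sum>b\<in>{..<N} - {a}. \<bar>C (a, b)\<bar>) \<le> (\<Sum>b\<in>{..<N} - {a}. 1 / \<bar>real a - real b\<bar> / (3 * N))"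
      proof (intro sum_mono)
        fix b assume b: "b \<in> {..<N} - {a}"
        have "\<bar>sin (2 * pi * (real a - real b) * R)\<bar> / (pi * \<bar>real a - real b\<bar>) \<le> 1 / (3 * \<bar>real a - real b\<bar>)"
          using b pi_gt3 by (intro frac_le mult_mono) auto
        then have "\<bar>sin (2 * pi * (real a - real b) * R)\<bar> / (pi * \<bar>real a - real b\<bar>) / N
            \<le> 1 / (3 * \<bar>real a - real b\<bar>) / N" by (intro divide_right_mono) auto
        moreover have "\<bar>C (a, b)\<bar> =
            \<bar>sin (2 * pi * (real a - real b) * R)\<bar> / (pi * \<bar>real a - real b\<bar>) / N"
          using b by (simp add: C_def abs_mult)
        ultimately show "\<bar>C (a, b)\<bar> \<le> 1 / \<bar>real a - real b\<bar> / (3 * N)" by simp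
      qed
      also have "\<dots> = (\<Sum>b\<in>{..<N} - {a}. 1 / \<bar>real a - real b\<bar>) / (3 * N)"
        by (simp add: sum_divide_distrib)
      also have "\<dots> \<le> 2 * (1 + ln (real N)) / (3 * N)"
        by (intro divide_right_mono sum_inverse_distance_le a) simp
      also have "ln (real N) = 3 * ln (real M)"
        using M by (simp add: N_def ln_realpow)
      also have "2 * (1 + 3 * ln (real M)) / (3 * N) = (2 / 3 + 2 * ln (real M)) / N"
        using N by (simp add: field_simps)
      also have "\<bar>C (a, a)\<bar> \<le> 4 / N"
      proof -
        have "1 / real M \<le> 1" using M by simp
        then have "2 * R + \<tau> \<le> 4" "2 * R + \<tau> \<ge> 0"
          using r by (auto simp: R_def \<delta>_def \<tau>_def)
        then show ?thesis using N by (auto simp: C_def intro!: divide_right_mono)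
      qed
      also have "4 / real N + (2 / 3 + 2 * ln (real M)) / N \<le> (6 + 3 * ln (real M)) / N"
        unfolding add_divide_distrib[symmetric]
        using M by (intro divide_right_mono) auto
      finally show "(\<Sum>b<N. \<bar>C (a, b)\<bar>) \<le> (6 + 3 * ln (real M)) / N" by simp
    qed
    also have "\<dots> = 6 + 3 * ln (real M)" using N by simp
    finally show ?thesis .
  qed
  ultimately show ?thesis unfolding J_def using that by blast
qed

section \<open>Majorants of boxes\<close>

abbreviation freq :: "('d::finite \<Rightarrow> int) \<Rightarrow> real^'d" where
  "freq \<kappa> \<equiv> (\<chi> i. of_int (\<kappa> i))"

definition trig_poly :: "('d::finite \<Rightarrow> int) set \<Rightarrow> (('d \<Rightarrow> int) \<Rightarrow> complex) \<Rightarrow> real^'d \<Rightarrow> complex" where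
  "trig_poly I C x = (\<Sum>\<kappa>\<in>I. C \<kappa> * cis (2 * pi * (freq \<kappa> \<bullet> x)))"

text \<open>The cube is parametrised by the \<open>M\<close> of \<open>arc_majorant\<close>; for \<open>M = 1\<close> it
  contains only the zero frequency.\<close>
definition freq_cube :: "nat \<Rightarrow> ('d::finite \<Rightarrow> int) set" where
  "freq_cube M = (UNIV \<rightarrow>\<^sub>E {1 - int M ^ 3..int M ^ 3 - 1})"

lemma finite_freq_cube [simp]: "finite (freq_cube M)"
  by (simp add: freq_cube_def finite_PiE)

lemma zero_in_freq_cube:
  assumes "M \<ge> 1"
  shows "(\<lambda>_. 0) \<in> freq_cube M"
proof -
  have "int M ^ 3 \<ge> 1" using assms by (intro one_le_power) simp
  then show ?thesis using assms by (simp add: freq_cube_def PiE_iff)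
qed

lemma norm_freq_le:
  assumes "\<kappa> \<in> (freq_cube M :: ('d::finite \<Rightarrow> int) set)"
  shows "norm (freq \<kappa>) \<le> real CARD('d) * (real M ^ 3 - 1)"
proof -
  have "norm (freq \<kappa>) \<le> (\<Sum>i\<in>UNIV. \<bar>freq \<kappa> $ i\<bar>)" by (rule norm_le_l1_cart)
  also have "\<dots> \<le> (\<Sum>i\<in>(UNIV::'d set). real M ^ 3 - 1)"
  proof (intro sum_mono)
    fix i
    have "1 - int M ^ 3 \<le> \<kappa> i \<and> \<kappa> i \<le> int M ^ 3 - 1"
      using assms by (simp add: freq_cube_def PiE_iff)
    then have "\<bar>\<kappa> i\<bar> \<le> int M ^ 3 - 1" by linarith
    then have "real_of_int \<bar>\<kappa> i\<bar> \<le> real_of_int (int M ^ 3 - 1)" by linarith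
    then show "\<bar>freq \<kappa> $ i\<bar> \<le> real M ^ 3 - 1" by simp
  qed
  finally show ?thesis by simp
qed

lemma norm_freq_ge_1:
  assumes "\<kappa> \<noteq> (\<lambda>_. 0)"
  shows "norm (freq \<kappa>) \<ge> 1"
proof -
  obtain i where "\<kappa> i \<noteq> 0" using assms by blast
  then have "1 \<le> \<bar>\<kappa> i\<bar>" by simp
  then have "1 \<le> real_of_int \<bar>\<kappa> i\<bar>" by linarith
  then have "1 \<le> \<bar>freq \<kappa> $ i\<bar>" by simp
  also have "\<dots> \<le> norm (freq \<kappa>)" by (rule component_le_norm_cart)
  finally show ?thesis .
qed

text \<open>The product over the coordinates of majorants of arcs. Translation by \<open>y\<close> only
  multiplies the coefficients by unimodular factors.\<close>
lemma box_majorant: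
  fixes y :: "real^'d" and r :: "'d \<Rightarrow> real" and M :: nat
  assumes M: "M \<ge> 1" and r: "\<And>i. 0 < r i \<and> r i < 1 / 2"
  obtains C :: "('d \<Rightarrow> int) \<Rightarrow> complex" and g :: "real^'d \<Rightarrow> real" where
    "\<And>x. of_real (g x) = trig_poly (freq_cube M) C x"
    "\<And>x. g x \<ge> 0"
    "\<And>x. (\<forall>i. dist_int (x $ i - y $ i) \<le> r i) \<Longrightarrow> g x \<ge> 1"
    "C (\<lambda>_. 0) = of_real (\<Prod>i\<in>UNIV. 2 * r i + 3 / M)"
    "(\<Sum>\<kappa>\<in>freq_cube M. norm (C \<kappa>)) \<le> (6 + 3 * ln (real M)) ^ CARD('d)"
proof -
  define J where "J = {1 - int M ^ 3..int M ^ 3 - 1}"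
  define maj where "maj i c h \<longleftrightarrow>
      (\<forall>x. of_real (h x) = (\<Sum>k\<in>J. of_real (c k) * cis (2 * pi * of_int k * x))) \<and>
      (\<forall>x. h x \<ge> 0) \<and> (\<forall>x. dist_int x \<le> r i \<longrightarrow> h x \<ge> 1) \<and> c 0 = 2 * r i + 3 / M \<and>
      (\<Sum>k\<in>J. \<bar>c k\<bar>) \<le> 6 + 3 * ln (real M)"
    for i and c :: "int \<Rightarrow> real" and h :: "real \<Rightarrow> real"
  have "\<exists>c h. maj i c h" for i
  proof -
    have "0 < r i" "r i < 1 / 2" using r by auto
    then show ?thesis
    proof (rule arc_majorant[OF M])
      fix c g
      assume "\<And>x. complex_of_real (g x) = (\<Sum>k\<in>{1 - int M ^ 3..int M ^ 3 - 1}. of_real (c k) * cis (2 * pi * of_int k * x))"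
        "\<And>x. g x \<ge> 0" "\<And>x. dist_int x \<le> r i \<Longrightarrow> g x \<ge> 1" "c 0 = 2 * r i + 3 / M"
        "(\<Sum>k\<in>{1 - int M ^ 3..int M ^ 3 - 1}. \<bar>c k\<bar>) \<le> 6 + 3 * ln (real M)"
      then have "maj i c g" unfolding maj_def J_def by blast
      then show ?thesis by blast
    qed
  qed
  then obtain c h where ch: "\<And>i. maj i (c i) (h i)" by metis
  have h: "of_real (h i x) = (\<Sum>k\<in>J. of_real (c i k) * cis (2 * pi * of_int k * x))"
    and h0: "h i x \<ge> 0" and h1: "dist_int x \<le> r i \<Longrightarrow> h i x \<ge> 1"
    and c0: "c i 0 = 2 * r i + 3 / M" and c: "(\<Sum>k\<in>J. \<bar>c i k\<bar>) \<le> 6 + 3 * ln (real M)" for i x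
    using ch[of i] by (auto simp: maj_def)
  define g where "g x = (\<Prod>i\<in>UNIV. h i (x $ i - y $ i))" for x
  define C where "C \<kappa> = (\<Prod>i\<in>UNIV. of_real (c i (\<kappa> i))) * cis (- 2 * pi * (freq \<kappa> \<bullet> y))" for \<kappa>
  have cube: "freq_cube M = (UNIV \<rightarrow>\<^sub>E J :: ('d \<Rightarrow> int) set)" by (simp add: freq_cube_def J_def)
  have cis_prod: "(\<Prod>i\<in>A. cis (f i)) = cis (sum f A)" for f :: "'d \<Rightarrow> real" and A
    by (induction A rule: infinite_finite_induct) (auto simp: cis_mult)
  show ?thesis
  proof (rule that[of g C])
    fix x
    have "complex_of_real (g x) = (\<Prod>i\<in>UNIV. \<Sum>k\<in>J. of_real (c i k) * cis (2 * pi * of_int k * (x $ i - y $ i)))"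
      by (simp add: g_def h)
    also have "\<dots> = (\<Sum>\<kappa>\<in>UNIV \<rightarrow>\<^sub>E J. \<Prod>i\<in>UNIV. of_real (c i (\<kappa> i)) * cis (2 * pi * of_int (\<kappa> i) * (x $ i - y $ i)))"
      by (subst prod_sum_PiE) (auto simp: J_def)
    also have "\<dots> = trig_poly (freq_cube M) C x"
      unfolding trig_poly_def cube
    proof (intro sum.cong refl)
      fix \<kappa>
      have "(\<Sum>i\<in>UNIV. 2 * pi * of_int (\<kappa> i) * (x $ i - y $ i)) =
        - 2 * pi * (freq \<kappa> \<bullet> y) + 2 * pi * (freq \<kappa> \<bullet> x)"
        by (simp add: inner_vec_def sum_distrib_left sum_negf[symmetric] sum.distrib[symmetric] algebra_simps)
      then show "(\<Prod>i\<in>UNIV. of_real (c i (\<kappa> i)) * cis (2 * pi * of_int (\<kappa> i) * (x $ i - y $ i))) =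
         C \<kappa> * cis (2 * pi * (freq \<kappa> \<bullet> x))"
        by (simp add: C_def prod.distrib cis_prod cis_mult mult.assoc)
    qed
    finally show "of_real (g x) = trig_poly (freq_cube M) C x" .
    show "g x \<ge> 0" unfolding g_def by (intro prod_nonneg) (simp add: h0)
    show "g x \<ge> 1" if "\<forall>i. dist_int (x $ i - y $ i) \<le> r i"
      unfolding g_def using that by (intro prod_ge_1) (simp add: h1)
  next
    show "C (\<lambda>_. 0) = of_real (\<Prod>i\<in>UNIV. 2 * r i + 3 / M)"
      by (simp add: C_def c0 inner_vec_def)
  next
    have "(\<Sum>\<kappa>\<in>freq_cube M. norm (C \<kappa>)) = (\<Sum>\<kappa>\<in>UNIV \<rightarrow>\<^sub>E J. \<Prod>i\<in>UNIV. \<bar>c i (\<kappa> i)\<bar>)"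
      unfolding cube by (intro sum.cong refl) (simp add: C_def norm_mult flip: prod_norm)
    also have "\<dots> = (\<Prod>i\<in>UNIV. \<Sum>k\<in>J. \<bar>c i k\<bar>)"
      by (subst prod_sum_PiE) (auto simp: J_def)
    also have "\<dots> \<le> (\<Prod>i\<in>(UNIV::'d set). 6 + 3 * ln (real M))"
      by (intro prod_mono) (auto intro!: sum_nonneg c)
    finally show "(\<Sum>\<kappa>\<in>freq_cube M. norm (C \<kappa>)) \<le> (6 + 3 * ln (real M)) ^ CARD('d)" by simp
  qed
qed

text \<open>Raising every side length of a box in the unit cube by \<open>t\<close> raises the volume by
  \<open>O(t)\<close>, uniformly in the box: this bounds the mean of a box majorant when some sides
  are much shorter than the excess.\<close>
lemma prod_add_le:
  fixes a :: "'i \<Rightarrow> real"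
  assumes "finite A" "\<And>i. i \<in> A \<Longrightarrow> 0 \<le> a i \<and> a i \<le> 1" "0 \<le> t" "t \<le> 3"
  shows "(\<Prod>i\<in>A. a i + t) \<le> (\<Prod>i\<in>A. a i) + 5 ^ card A * t"
  using assms(1,2)
proof (induction A rule: finite_induct)
  case empty
  then show ?case using assms by simp
next
  case (insert j A)
  define P where "P = (\<Prod>i\<in>A. a i)"
  have P: "0 \<le> P" "P \<le> 1" using insert by (auto simp: P_def intro!: prod_nonneg prod_le_1)
  have j: "0 \<le> a j" "a j \<le> 1" using insert by auto
  have 5: "(5::real) ^ card A \<ge> 1" by simp
  have "(\<Prod>i\<in>insert j A. a i + t) = (a j + t) * (\<Prod>i\<in>A. a i + t)"
    using insert by simp
  also have "\<dots> \<le> (a j + t) * (P + 5 ^ card A * t)"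
    using insert assms j by (intro mult_left_mono) (auto simp: P_def)
  also have "\<dots> = a j * P + (a j * (5 ^ card A * t) + t * P + t * (5 ^ card A * t))"
    by (simp add: algebra_simps)
  also have "\<dots> \<le> a j * P + (1 * (5 ^ card A * t) + 5 ^ card A * t + 3 * (5 ^ card A * t))"
  proof -
    have "P \<le> 5 ^ card A" using P(2) 5 by (rule order_trans)
    then have "t * P \<le> t * 5 ^ card A" using assms by (intro mult_left_mono) auto
    moreover have "a j * (5 ^ card A * t) \<le> 1 * (5 ^ card A * t)"
      using j assms by (intro mult_right_mono) auto
    moreover have "t * (5 ^ card A * t) \<le> 3 * (5 ^ card A * t)"
      using j assms by (intro mult_right_mono) auto
    ultimately show ?thesis by (simp add: mult.commute)
  qed
  also have "\<dots> = (\<Prod>i\<in>insert j A. a i) + 5 ^ card (insert j A) * t"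
    using insert by (simp add: P_def)
  finally show ?case .
qed

section \<open>Growth of frequencies\<close>

definition expands :: "real \<Rightarrow> real^'d^'d \<Rightarrow> bool" where
  "expands \<kappa> B \<longleftrightarrow> (\<forall>v. \<kappa> * norm v \<le> norm (B *v v))"

lemma matrix_inv_cancel:
  fixes B :: "real^'d^'d"
  assumes "invertible B"
  shows "B ** matrix_inv B = mat 1" "matrix_inv B ** B = mat 1"
  using someI_ex[OF assms[unfolded invertible_def]] by (simp_all add: matrix_inv_def)

lemma expands_smallest_singular_value:
  fixes B :: "real^'d^'d"
  assumes "smallest_singular_value B \<ge> \<kappa>"
  shows "expands \<kappa> B"
  unfolding expands_def
proof
  fix v :: "real^'d"
  show "\<kappa> * norm v \<le> norm (B *v v)"
  proof (cases "v = 0")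
    case False
    define u where "u = (1 / norm v) *\<^sub>R v"
    have "norm u = 1" using False by (simp add: u_def)
    then have "smallest_singular_value B \<le> norm (B *v u)"
      unfolding smallest_singular_value_def by (intro cInf_lower bdd_belowI[of _ 0]) auto
    also have "\<dots> = norm (B *v v) / norm v"
      by (simp add: u_def matrix_vector_mult_scaleR)
    finally have "smallest_singular_value B * norm v \<le> norm (B *v v)"
      using False by (simp add: field_simps)
    moreover have "\<kappa> * norm v \<le> smallest_singular_value B * norm v"
      using assms by (intro mult_right_mono) auto
    ultimately show ?thesis by linarith
  qed simp
qed

lemma expands_mult:
  assumes "expands a B" "expands b B'" "a \<ge> 0"
  shows "expands (a * b) (B ** B')"
  unfolding expands_def
proof
  fix v
  have "a * b * norm v \<le> a * norm (B' *v v)"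
    using assms by (simp add: expands_def mult_left_mono mult.assoc)
  also have "\<dots> \<le> norm (B *v (B' *v v))" using assms by (simp add: expands_def)
  finally show "a * b * norm v \<le> norm ((B ** B') *v v)" by (simp add: matrix_vector_mul_assoc)
qed

lemma expands_inj:
  assumes "expands \<kappa> B" "\<kappa> > 0"
  shows "inj ((*v) B)"
proof (rule injI)
  fix v w assume "B *v v = B *v w"
  then have "\<kappa> * norm (v - w) \<le> 0"
    using assms(1)[unfolded expands_def, rule_format, of "v - w"]
    by (simp add: matrix_vector_mult_diff_distrib)
  then show "v = w" using assms(2) by (simp add: mult_le_0_iff)
qed

text \<open>A square matrix and its transpose have the same smallest singular value. The lower bound
  passes to the transpose by duality: write \<open>w = B v\<close> with \<open>norm v \<le> norm w / \<kappa>\<close>,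
  which is possible because \<open>B\<close> is onto, and apply Cauchy--Schwarz to
  \<open>w \<bullet> w = (w v* B) \<bullet> v\<close>.\<close>
lemma expands_transpose:
  fixes B :: "real^'d^'d"
  assumes "expands \<kappa> B" "\<kappa> > 0"
  shows "\<kappa> * norm w \<le> norm (w v* B)"
proof (cases "w = 0")
  case False
  have "surj ((*v) B)"
    using expands_inj[OF assms] linear_injective_imp_surjective[OF matrix_vector_mul_linear] by blast
  then obtain v where v: "B *v v = w" by (metis surjD)
  have "(norm w)\<^sup>2 = w \<bullet> (B *v v)" by (simp add: v power2_norm_eq_inner)
  also have "\<dots> = (w v* B) \<bullet> v" by (simp add: dot_lmul_matrix)
  also have "\<dots> \<le> norm (w v* B) * norm v" by (rule norm_cauchy_schwarz)
  finally have "\<kappa> * (norm w)\<^sup>2 \<le> \<kappa> * (norm (w v* B) * norm v)"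
    using assms by (simp add: mult_left_mono)
  also have "\<dots> = norm (w v* B) * (\<kappa> * norm v)" by (simp add: mult_ac)
  also have "\<dots> \<le> norm (w v* B) * norm w"
    using assms(1)[unfolded expands_def, rule_format, of v] v by (intro mult_left_mono) auto
  finally show ?thesis using False by (simp add: power2_eq_square)
qed simp

lemma expands_invertible:
  fixes B :: "real^'d^'d"
  assumes "invertible B"
  obtains \<kappa> where "\<kappa> > 0" "expands \<kappa> B"
proof -
  have "linear ((*v) (matrix_inv B))" by (rule matrix_vector_mul_linear)
  then have "bounded_linear ((*v) (matrix_inv B))" by (rule linear_conv_bounded_linear[THEN iffD1])
  then obtain L where L: "L > 0" "\<And>v. norm (matrix_inv B *v v) \<le> norm v * L"
    using bounded_linear.pos_bounded by blast
  have "expands (1 / L) B" unfolding expands_def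
  proof
    fix v
    have "matrix_inv B *v (B *v v) = v"
      using matrix_inv_cancel(2)[OF assms] by (simp add: matrix_vector_mul_assoc)
    then have "norm v \<le> norm (B *v v) * L" using L(2)[of "B *v v"] by simp
    then show "1 / L * norm v \<le> norm (B *v v)" using L(1) by (simp add: field_simps)
  qed
  then show ?thesis using L(1) that[of "1 / L"] by simp
qed

text \<open>A kernel vector would be an eigenvector, after complexification, for the eigenvalue 0.\<close>
lemma expanding_integral_invertible:
  fixes B :: "real^'d^'d"
  assumes "expanding_integral B"
  shows "invertible B"
proof -
  have "v = 0" if v: "B *v v = 0" for v
  proof (rule ccontr)
    assume nz: "v \<noteq> 0"
    define w :: "complex^'d" where "w = (\<chi> i. of_real (v $ i))"
    have "w \<noteq> 0" using nz by (auto simp: w_def vec_eq_iff)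
    moreover have "map_matrix complex_of_real B *v w = 0 *s w"
    proof -
      have "(map_matrix complex_of_real B *v w) $ i = of_real ((B *v v) $ i)" for i
        by (simp add: w_def map_matrix_def matrix_vector_mult_def)
      then show ?thesis using v by (simp add: vec_eq_iff)
    qed
    ultimately have "complex_eigenvalue B 0" unfolding complex_eigenvalue_def by blast
    then show False using assms by (auto simp: expanding_integral_def)
  qed
  then have "inj ((*v) B)"
    by (intro injI) (metis matrix_vector_mult_diff_distrib right_minus_eq)
  then show ?thesis
    using invertible_left_inverse matrix_left_invertible_injective by blast
qed

context
  fixes A :: "nat \<Rightarrow> real^'d^'d" and K :: real
  assumes inv: "\<And>n. n \<ge> 1 \<Longrightarrow> invertible (A n)"
    and K: "K > 1"
    and lac: "\<And>n. n \<ge> 1 \<Longrightarrow> expands K (A (n + 1) ** matrix_inv (A n))"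
begin

lemma expands_quotient:
  assumes "m \<ge> 1"
  shows "expands (K ^ j) (A (m + j) ** matrix_inv (A m))"
proof (induction j)
  case 0
  then show ?case using matrix_inv_cancel(1)[OF inv[OF assms]] by (simp add: expands_def)
next
  case (Suc j)
  have "A (m + Suc j) ** matrix_inv (A m) =
      A (m + j + 1) ** (matrix_inv (A (m + j)) ** A (m + j)) ** matrix_inv (A m)"
    using matrix_inv_cancel(2)[OF inv[of "m + j"]] assms by simp
  also have "\<dots> = (A (m + j + 1) ** matrix_inv (A (m + j))) ** (A (m + j) ** matrix_inv (A m))"
    by (simp only: matrix_mul_assoc)
  finally show ?case
    using expands_mult[OF lac[of "m + j"] Suc] assms K by simp
qed

text \<open>This is where lacunarity enters. A product of two characters of frequencies \<open>k\<close> and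
  \<open>l\<close>, evaluated at \<open>A m x\<close> and \<open>A n x\<close>, is the character of \<open>x\<close> with
  frequency \<open>k v* A m + l v* A n = (k + l v* Q) v* A m\<close>, where
  \<open>Q = A n ** matrix_inv (A m)\<close> expands by \<open>K ^ (n - m)\<close>. As long as \<open>k\<close> is at
  most half that large the term \<open>l v* Q\<close> dominates, so no cancellation can occur and the
  frequency is as large as that of a single character at \<open>A n x\<close>, however large
  \<open>l\<close> is.\<close>
lemma frequency_growth:
  obtains c where "c > 0"
    "\<And>n w. n \<ge> 1 \<Longrightarrow> norm w \<ge> 1 \<Longrightarrow> norm (w v* A n) \<ge> c * K ^ n"
    "\<And>m n k l. 1 \<le> m \<Longrightarrow> m < n \<Longrightarrow> norm k \<le> K ^ (n - m) / 2 \<Longrightarrow> norm l \<ge> 1 \<Longrightarrow>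
       norm (k v* A m + l v* A n) \<ge> c * K ^ n"
proof -
  obtain \<kappa> where \<kappa>: "\<kappa> > 0" "expands \<kappa> (A 1)" using expands_invertible[OF inv[of 1]] by auto
  have base: "\<kappa> / K * K ^ n * norm w \<le> norm (w v* A n)" if n: "n \<ge> 1" for n w
  proof -
    have "A n = A n ** (matrix_inv (A 1) ** A 1)"
      using matrix_inv_cancel(2)[OF inv[of 1]] by simp
    also have "\<dots> = (A (1 + (n - 1)) ** matrix_inv (A 1)) ** A 1"
      using n by (simp add: matrix_mul_assoc)
    finally have "expands (K ^ (n - 1) * \<kappa>) (A n)"
      using expands_mult[OF expands_quotient[of 1 "n - 1"] \<kappa>(2)] K by simp
    then have "K ^ (n - 1) * \<kappa> * norm w \<le> norm (w v* A n)"
      by (rule expands_transpose) (use K \<kappa> in simp)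
    moreover have "K ^ n = K * K ^ (n - 1)" using n by (cases n) auto
    ultimately show ?thesis using K by (simp add: mult_ac)
  qed
  show ?thesis
  proof (rule that[of "\<kappa> / (2 * K)"])
    show "\<kappa> / (2 * K) > 0" using \<kappa> K by simp
  next
    fix n :: nat and w :: "real^'d" assume "n \<ge> 1" and w: "norm w \<ge> 1"
    have "\<kappa> / (2 * K) * K ^ n \<le> \<kappa> / K * K ^ n"
      using \<kappa> K by (intro mult_right_mono) (auto simp: field_simps)
    also have "\<dots> \<le> \<kappa> / K * K ^ n * norm w"
      using \<kappa> K w mult_left_mono[of 1 "norm w" "\<kappa> / K * K ^ n"] by simp
    also have "\<dots> \<le> norm (w v* A n)" using base[OF \<open>n \<ge> 1\<close>] .
    finally show "norm (w v* A n) \<ge> \<kappa> / (2 * K) * K ^ n" .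
  next
    fix m n :: nat and k l :: "real^'d"
    assume mn: "1 \<le> m" "m < n" and k: "norm k \<le> K ^ (n - m) / 2" and l: "norm l \<ge> 1"
    define Q where "Q = A n ** matrix_inv (A m)"
    have "expands (K ^ (n - m)) Q"
      using expands_quotient[OF mn(1), of "n - m"] mn by (simp add: Q_def)
    then have "K ^ (n - m) * norm l \<le> norm (l v* Q)"
      by (rule expands_transpose) (use K in simp)
    moreover have "K ^ (n - m) * 1 \<le> K ^ (n - m) * norm l"
      using K l by (intro mult_left_mono) auto
    moreover have "norm (l v* Q) - norm k \<le> norm (k + l v* Q)"
      using norm_diff_ineq[of "l v* Q" k] by (simp add: add.commute)
    ultimately have "K ^ (n - m) / 2 \<le> norm (k + l v* Q)" using k by simp
    then have "\<kappa> / K * K ^ m * (K ^ (n - m) / 2) \<le> \<kappa> / K * K ^ m * norm (k + l v* Q)"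
      using \<kappa> K by (intro mult_left_mono) auto
    also have "\<dots> \<le> norm ((k + l v* Q) v* A m)" using base[OF mn(1)] .
    also have "(k + l v* Q) v* A m = k v* A m + l v* (Q ** A m)"
      by (simp add: vector_matrix_left_distrib vector_matrix_mul_assoc)
    also have "Q ** A m = A n ** (matrix_inv (A m) ** A m)"
      by (simp add: Q_def matrix_mul_assoc)
    also have "\<dots> = A n" using matrix_inv_cancel(2)[OF inv[OF mn(1)]] by simp
    also have "\<kappa> / K * K ^ m * (K ^ (n - m) / 2) = \<kappa> / (2 * K) * (K ^ m * K ^ (n - m))"
      by simp
    also have "K ^ m * K ^ (n - m) = K ^ n"
      using mn by (simp flip: power_add)
    finally show "norm (k v* A m + l v* A n) \<ge> \<kappa> / (2 * K) * K ^ n" .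
  qed
qed

end

section \<open>Decay of the Fourier transform along the frequencies\<close>

lemma norm_fourier_le_1:
  assumes "prob_space M" 
  shows "norm (fourier M t) \<le> 1"
proof -
  interpret prob_space M by fact
  have "norm (fourier M t) \<le> (LINT x|M. norm (exp (- 2 * complex_of_real pi * \<i> * complex_of_real (t \<bullet> x))))"
    unfolding fourier_def by (rule integral_norm_bound)
  also have "\<dots> = (LINT x|M. 1)"
    by (intro Bochner_Integration.integral_cong refl) (simp add: norm_exp_eq_Re)
  also have "\<dots> = 1" by (simp add: prob_space)
  finally show ?thesis .
qed

text \<open>A logarithmic rate of decay turns into the power \<open>n powr (- s)\<close> along frequencies
  growing exponentially in \<open>n\<close>. The finitely many \<open>n\<close> below the range of the
  asymptotic hypothesis are absorbed into \<open>D\<close>.\<close>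
lemma fourier_decay_exponential_frequency:
  fixes M :: "(real^'d) measure"
  assumes "prob_space M" and "K > 1" and "c > 0" and "s > 0"
    and decay: "(\<lambda>t. norm (fourier M t)) \<in> O[filtercomap infnorm at_top](\<lambda>t. ln (infnorm t) powr (- s))"
  obtains D where "D > 0"
    "\<And>n t. n \<ge> 1 \<Longrightarrow> norm t \<ge> c * K ^ n \<Longrightarrow> norm (fourier M t) \<le> D * real n powr (- s)"
proof -
  obtain c1 where c1: "c1 > 0" and
    "eventually (\<lambda>t. norm (norm (fourier M t)) \<le> c1 * norm (ln (infnorm t) powr (- s)))
       (filtercomap infnorm at_top)"
    using decay by (elim landau_o.bigE)
  then obtain T where T: "\<And>t. infnorm t \<ge> T \<Longrightarrow> norm (fourier M t) \<le> c1 * ln (infnorm t) powr (- s)"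
    by (auto simp: eventually_filtercomap_at_top_linorder)
  define c' where "c' = c / sqrt (real DIM(real^'d))"
  have c': "c' > 0" using \<open>c > 0\<close> by (simp add: c'_def)
  have lnK: "ln K > 0" using \<open>K > 1\<close> by simp
  have ev1: "eventually (\<lambda>n. c' * K ^ n \<ge> max T 1) sequentially"
  proof -
    have "filterlim (\<lambda>n. c' * K ^ n) at_top sequentially"
      using \<open>K > 1\<close> c' by real_asymp
    then show ?thesis unfolding filterlim_at_top by blast
  qed
  have ev2: "eventually (\<lambda>n. - ln c' \<le> real n * (ln K / 2)) sequentially"
  proof -
    have "filterlim (\<lambda>n. real n * (ln K / 2)) at_top sequentially"
      using lnK by (intro filterlim_at_top_mult_tendsto_pos[OF tendsto_const] filterlim_real_sequentially) auto
    then show ?thesis unfolding filterlim_at_top by blast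
  qed
  obtain n0 where n0: "\<And>n. n \<ge> n0 \<Longrightarrow> c' * K ^ n \<ge> max T 1 \<and> - ln c' \<le> real n * (ln K / 2)"
    using eventually_conj[OF ev1 ev2] by (auto simp: eventually_sequentially)
  define D where "D = c1 * (ln K / 2) powr (- s) + real n0 powr s + 1"
  show ?thesis
  proof (rule that[of D])
    show "D > 0" unfolding D_def using c1 by (intro add_nonneg_pos add_nonneg_nonneg) auto
  next
    fix n :: nat and t :: "real^'d" assume n: "n \<ge> 1" and t: "norm t \<ge> c * K ^ n"
    show "norm (fourier M t) \<le> D * real n powr (- s)"
    proof (cases "n \<ge> n0")
      case True
      have "c * K ^ n \<le> sqrt (real DIM(real^'d)) * infnorm t"
        using t norm_le_infnorm[of t] by linarith
      then have inf: "c' * K ^ n \<le> infnorm t"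
        by (simp add: c'_def field_simps)
      have "real n * (ln K / 2) \<le> ln c' + real n * ln K" using n0[OF True] by simp
      also have "\<dots> = ln (c' * K ^ n)" using c' \<open>K > 1\<close> by (simp add: ln_mult ln_realpow)
      also have "\<dots> \<le> ln (infnorm t)" using inf n0[OF True] c' \<open>K > 1\<close> by (subst ln_le_cancel_iff) auto
      finally have "ln (infnorm t) powr (- s) \<le> (real n * (ln K / 2)) powr (- s)"
        using lnK n \<open>s > 0\<close> by (intro powr_mono2') auto
      then have "c1 * ln (infnorm t) powr (- s) \<le> c1 * (real n * (ln K / 2)) powr (- s)"
        using c1 by (intro mult_left_mono) auto
      also have "\<dots> = c1 * (ln K / 2) powr (- s) * real n powr (- s)"
        using lnK by (subst powr_mult) (auto simp: mult_ac)
      also have "\<dots> \<le> D * real n powr (- s)"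
        unfolding D_def by (intro mult_right_mono) auto
      finally show ?thesis using T[of t] inf n0[OF True] by simp
    next
      case False
      have "1 = real n powr s * real n powr (- s)" using n by (simp flip: powr_add)
      also have "\<dots> \<le> real n0 powr s * real n powr (- s)"
        using False \<open>s > 0\<close> by (intro mult_right_mono powr_mono2) auto
      also have "\<dots> \<le> D * real n powr (- s)"
        unfolding D_def using c1 by (intro mult_right_mono) auto
      finally show ?thesis using norm_fourier_le_1[OF \<open>prob_space M\<close>, of t] by linarith
    qed
  qed
qed

section \<open>Measures of targets and of their intersections\<close>

definition hit_set :: "real^'d^'d \<Rightarrow> real^'d \<Rightarrow> ('d \<Rightarrow> real) \<Rightarrow> (real^'d) set" where
  "hit_set B y \<rho> = {x. \<forall>i. dist_int ((B *v x) $ i - y $ i) \<le> \<rho> i}"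

lemma dist_int_measurable [measurable]: "dist_int \<in> borel_measurable borel"
  unfolding dist_int_eq_round[abs_def] round_def by measurable

lemma borel_measurable_matrix_vector [measurable]:
  fixes B :: "real^'d^'d"
  shows "(\<lambda>x. (B *v x) $ i) \<in> borel_measurable borel"
proof -
  have "linear (\<lambda>x. B *v x)" by (rule matrix_vector_mul_linear)
  then have "continuous_on UNIV (\<lambda>x. (B *v x) $ i)"
    by (intro continuous_on_component linear_continuous_on linear_conv_bounded_linear[THEN iffD1])
  then show ?thesis by (rule borel_measurable_continuous_onI)
qed

lemma hit_set_borel [measurable]:
  fixes B :: "real^'d^'d"
  shows "hit_set B y \<rho> \<in> sets borel"
proof -
  have "hit_set B y \<rho> = (\<Inter>i. {x \<in> space borel. dist_int ((B *v x) $ i - y $ i) \<le> \<rho> i})"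
    by (auto simp: hit_set_def)
  also have "\<dots> \<in> sets borel"
    by (intro sets.finite_INT) (auto intro!: borel_measurable_le)
  finally show ?thesis .
qed

text \<open>The interface between harmonic analysis and probability: lacunarity of the matrices and
  decay of the Fourier transform enter the estimates for the targets only through the values of
  the transform at the frequencies that one target, or a pair of targets, can produce.\<close>
locale decaying_frequencies = prob_space M
  for M :: "(real^'d) measure" +
  fixes A :: "nat \<Rightarrow> real^'d^'d" and K s D :: real
  assumes sets_M [measurable_cong]: "sets M = sets borel"
    and K: "K > 1" and s: "s > 2" and D: "D > 0"
    and decay: "\<And>n l. n \<ge> 1 \<Longrightarrow> norm l \<ge> 1 \<Longrightarrow>
      norm (fourier M (- (l v* A n))) \<le> D * real n powr (- s)"
    and decay2: "\<And>m n k l. 1 \<le> m \<Longrightarrow> m < n \<Longrightarrow> norm k \<le> K ^ (n - m) / 2 \<Longrightarrow> norm l \<ge> 1 \<Longrightarrow>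
      norm (fourier M (- (k v* A m + l v* A n))) \<le> D * real n powr (- s)"
begin

lemma char_integral:
  "integrable M (\<lambda>x. cis (2 * pi * (t \<bullet> x)))" (is ?A)
  "(CLINT x|M. cis (2 * pi * (t \<bullet> x))) = fourier M (- t)" (is ?B)
proof -
  have [measurable]: "(\<lambda>x. cis (2 * pi * (t \<bullet> x))) \<in> borel_measurable borel"
    by (intro borel_measurable_continuous_onI continuous_intros)
  have "(\<lambda>x. cis (2 * pi * (t \<bullet> x))) \<in> borel_measurable M"
    using sets_M by measurable
  then show ?A by (intro integrable_const_bound[where B = 1]) auto
  show ?B by (simp add: fourier_def cis_conv_exp mult_ac)
qed

lemma integral_trig_poly:
  assumes "finite I"
  shows "integrable M (\<lambda>x. trig_poly I C (B *v x))" (is ?A)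
    "(CLINT x|M. trig_poly I C (B *v x)) = (\<Sum>\<kappa>\<in>I. C \<kappa> * fourier M (- (freq \<kappa> v* B)))" (is ?B)
proof -
  have eq: "trig_poly I C (B *v x) = (\<Sum>\<kappa>\<in>I. C \<kappa> * cis (2 * pi * ((freq \<kappa> v* B) \<bullet> x)))" for x
    by (simp add: trig_poly_def dot_lmul_matrix)
  show ?A ?B unfolding eq by (simp_all add: char_integral)
qed

lemma integral_trig_poly_mult:
  assumes "finite I" "finite J"
  shows "integrable M (\<lambda>x. trig_poly I C (B *v x) * trig_poly J C' (B' *v x))" (is ?A)
    "(CLINT x|M. trig_poly I C (B *v x) * trig_poly J C' (B' *v x)) =
      (\<Sum>\<kappa>\<in>I. \<Sum>\<eta>\<in>J. C \<kappa> * C' \<eta> * fourier M (- (freq \<kappa> v* B + freq \<eta> v* B')))" (is ?B)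
proof -
  have eq: "trig_poly I C (B *v x) * trig_poly J C' (B' *v x) =
      (\<Sum>\<kappa>\<in>I. \<Sum>\<eta>\<in>J. C \<kappa> * C' \<eta> * cis (2 * pi * ((freq \<kappa> v* B + freq \<eta> v* B') \<bullet> x)))" for x
  proof -
    have "cis (2 * pi * ((freq \<kappa> v* B + freq \<eta> v* B') \<bullet> x)) =
        cis (2 * pi * (freq \<kappa> \<bullet> (B *v x))) * cis (2 * pi * (freq \<eta> \<bullet> (B' *v x)))" for \<kappa> \<eta>
      by (simp add: cis_mult inner_add_left dot_lmul_matrix distrib_left)
    then show ?thesis by (simp add: trig_poly_def sum_product mult_ac)
  qed
  show ?A ?B unfolding eq by (simp_all add: char_integral)
qed

lemma measure_hit_set_le:
  assumes n: "n \<ge> 1" and M: "N \<ge> 1" and \<rho>: "\<And>i. 0 < \<rho> i \<and> \<rho> i < 1 / 2"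
  shows "measure M (hit_set (A n) y \<rho>) \<le>
    (\<Prod>i\<in>UNIV. 2 * \<rho> i + 3 / real N) + (6 + 3 * ln (real N)) ^ CARD('d) * (D * real n powr (- s))"
proof -
  obtain C g where g: "\<And>x. of_real (g x) = trig_poly (freq_cube N) C x" "\<And>x. g x \<ge> 0"
    "\<And>x. (\<forall>i. dist_int (x $ i - y $ i) \<le> \<rho> i) \<Longrightarrow> g x \<ge> 1"
    "C (\<lambda>_. 0) = of_real (\<Prod>i\<in>UNIV. 2 * \<rho> i + 3 / real N)"
    "(\<Sum>\<kappa>\<in>freq_cube N. norm (C \<kappa>)) \<le> (6 + 3 * ln (real N)) ^ CARD('d)"
    by (rule box_majorant[OF M, of \<rho> y]) (use \<rho> in auto)
  let ?Z = "\<lambda>_::'d. 0::int" and ?e = "D * real n powr (- s)"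
  have int: "integrable M (\<lambda>x. g (A n *v x))"
    using integral_trig_poly(1)[of "freq_cube N" C "A n"]
    by (simp add: complex_of_real_integrable_eq flip: g(1))
  have "measure M (hit_set (A n) y \<rho>) = (LINT x|M. indicator (hit_set (A n) y \<rho>) x)"
    using sets_M by (simp add: hit_set_borel)
  also have "\<dots> \<le> (LINT x|M. g (A n *v x))"
  proof (intro integral_mono int)
    show "integrable M (indicator (hit_set (A n) y \<rho>) :: _ \<Rightarrow> real)"
      using sets_M by (simp add: hit_set_borel emeasure_eq_measure)
    show "indicator (hit_set (A n) y \<rho>) x \<le> g (A n *v x)" for x
      by (auto simp: hit_set_def indicator_def g)
  qed
  also have "\<dots> = norm (complex_of_real (LINT x|M. g (A n *v x)))"
    by (simp add: g(2) integral_nonneg_AE)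
  also have "complex_of_real (LINT x|M. g (A n *v x)) = (CLINT x|M. trig_poly (freq_cube N) C (A n *v x))"
    by (simp flip: g(1))
  also have "\<dots> = (\<Sum>\<kappa>\<in>freq_cube N. C \<kappa> * fourier M (- (freq \<kappa> v* A n)))"
    by (simp add: integral_trig_poly)
  also have "norm \<dots> \<le> (\<Sum>\<kappa>\<in>freq_cube N. norm (C \<kappa>) * (of_bool (\<kappa> = ?Z) + ?e))"
  proof (intro sum_norm_le)
    fix \<kappa> :: "'d \<Rightarrow> int" assume "\<kappa> \<in> freq_cube N"
    have "norm (fourier M (- (freq \<kappa> v* A n))) \<le> of_bool (\<kappa> = ?Z) + ?e"
    proof (cases "\<kappa> = ?Z")
      case True
      then show ?thesis
        using norm_fourier_le_1[OF prob_space_axioms, of "- (freq \<kappa> v* A n)"] D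
        by (simp add: add_increasing2)
    next
      case False
      then show ?thesis using decay[OF n norm_freq_ge_1[OF False]] by simp
    qed
    then show "norm (C \<kappa> * fourier M (- (freq \<kappa> v* A n))) \<le> norm (C \<kappa>) * (of_bool (\<kappa> = ?Z) + ?e)"
      unfolding norm_mult by (intro mult_left_mono) auto
  qed
  also have "\<dots> = norm (C ?Z) + (\<Sum>\<kappa>\<in>freq_cube N. norm (C \<kappa>)) * ?e"
  proof -
    have "(\<Sum>\<kappa>\<in>freq_cube N. norm (C \<kappa>) * of_bool (\<kappa> = ?Z)) = norm (C ?Z)"
      using zero_in_freq_cube[OF M] by (subst sum.remove[of _ ?Z]) auto
    then show ?thesis by (simp add: distrib_left sum.distrib sum_distrib_right)
  qed
  also have "\<dots> \<le> norm (C ?Z) + (6 + 3 * ln (real N)) ^ CARD('d) * ?e"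
    using g(5) D by (intro add_left_mono mult_right_mono) auto
  also have "norm (C ?Z) = (\<Prod>i\<in>UNIV. 2 * \<rho> i + 3 / real N)"
    unfolding g(4) norm_of_real using \<rho> by (intro abs_of_nonneg prod_nonneg) (simp add: less_imp_le add_nonneg_nonneg)
  finally show ?thesis .
qed

text \<open>Integrate the product of a majorant of degree parameter \<open>N\<close> at \<open>A m x\<close> and one of
  degree parameter \<open>N'\<close> at \<open>A n x\<close>. Pairs of frequencies \<open>(\<kappa>, \<eta>)\<close> with
  \<open>\<eta> = 0\<close> give the mean of the second majorant times the integral of the first; all others
  have exponentially large combined frequency, provided that \<open>N\<close> is small compared with
  \<open>K ^ (n - m)\<close>. There is no constraint on \<open>N'\<close>, so the later target can be
  approximated as finely as desired even when \<open>m\<close> and \<open>n\<close> are close.\<close>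
lemma measure_hit_set_Int_le:
  assumes mn: "1 \<le> m" "m < n" and N: "N \<ge> 1" "N' \<ge> 1"
    and deg: "real CARD('d) * (real N ^ 3 - 1) \<le> K ^ (n - m) / 2"
    and \<rho>: "\<And>i. 0 < \<rho> i \<and> \<rho> i < 1 / 2" and \<rho>': "\<And>i. 0 < \<rho>' i \<and> \<rho>' i < 1 / 2"
  shows "measure M (hit_set (A m) y \<rho> \<inter> hit_set (A n) y' \<rho>') \<le>
    ((\<Prod>i\<in>UNIV. 2 * \<rho> i + 3 / real N) + (6 + 3 * ln (real N)) ^ CARD('d) * (D * real m powr (- s)))
      * (\<Prod>i\<in>UNIV. 2 * \<rho>' i + 3 / real N')
    + (6 + 3 * ln (real N)) ^ CARD('d) * (6 + 3 * ln (real N')) ^ CARD('d) * (D * real n powr (- s))"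
proof -
  obtain C g where g: "\<And>x. of_real (g x) = trig_poly (freq_cube N) C x" "\<And>x. g x \<ge> 0"
    "\<And>x. (\<forall>i. dist_int (x $ i - y $ i) \<le> \<rho> i) \<Longrightarrow> g x \<ge> 1"
    "C (\<lambda>_. 0) = of_real (\<Prod>i\<in>UNIV. 2 * \<rho> i + 3 / real N)"
    "(\<Sum>\<kappa>\<in>freq_cube N. norm (C \<kappa>)) \<le> (6 + 3 * ln (real N)) ^ CARD('d)"
    by (rule box_majorant[OF N(1), of \<rho> y]) (use \<rho> in auto)
  obtain C' g' where g': "\<And>x. of_real (g' x) = trig_poly (freq_cube N') C' x" "\<And>x. g' x \<ge> 0"
    "\<And>x. (\<forall>i. dist_int (x $ i - y' $ i) \<le> \<rho>' i) \<Longrightarrow> g' x \<ge> 1"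
    "C' (\<lambda>_. 0) = of_real (\<Prod>i\<in>UNIV. 2 * \<rho>' i + 3 / real N')"
    "(\<Sum>\<kappa>\<in>freq_cube N'. norm (C' \<kappa>)) \<le> (6 + 3 * ln (real N')) ^ CARD('d)"
    by (rule box_majorant[OF N(2), of \<rho>' y']) (use \<rho>' in auto)
  let ?Z = "\<lambda>_::'d. 0::int"
  define em where "em = D * real m powr (- s)"
  define en where "en = D * real n powr (- s)"
  define I :: "('d \<Rightarrow> int) set" where "I = freq_cube N"
  define J :: "('d \<Rightarrow> int) set" where "J = freq_cube N'"
  have fin: "finite I" "finite J" and Z: "?Z \<in> I" "?Z \<in> J"
    using N by (simp_all add: I_def J_def zero_in_freq_cube)
  have e: "em \<ge> 0" "en \<ge> 0" using D by (simp_all add: em_def en_def)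
  let ?E = "hit_set (A m) y \<rho> \<inter> hit_set (A n) y' \<rho>'"
  have E: "?E \<in> sets M" using sets_M by simp
  have int: "integrable M (\<lambda>x. g (A m *v x) * g' (A n *v x))"
    using integral_trig_poly_mult(1)[of "freq_cube N" "freq_cube N'" C "A m" C' "A n"]
    by (simp only: complex_of_real_integrable_eq finite_freq_cube flip: g(1) g'(1) of_real_mult)
  have "measure M ?E = (LINT x|M. indicator ?E x)" using E by simp
  also have "\<dots> \<le> (LINT x|M. g (A m *v x) * g' (A n *v x))"
  proof (intro integral_mono int)
    show "integrable M (indicator ?E :: _ \<Rightarrow> real)" using E by (simp add: emeasure_eq_measure)
    fix x
    show "indicator ?E x \<le> g (A m *v x) * g' (A n *v x)"
    proof (cases "x \<in> ?E")
      case True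
      then have "1 * 1 \<le> g (A m *v x) * g' (A n *v x)"
        by (intro mult_mono g(3) g'(3) g(2)) (auto simp: hit_set_def)
      then show ?thesis using True by simp
    qed (simp add: g g')
  qed
  also have "\<dots> = norm (complex_of_real (LINT x|M. g (A m *v x) * g' (A n *v x)))"
    by (simp add: g(2) g'(2) integral_nonneg_AE)
  also have "complex_of_real (LINT x|M. g (A m *v x) * g' (A n *v x)) =
      (CLINT x|M. trig_poly I C (A m *v x) * trig_poly J C' (A n *v x))"
    by (simp add: I_def J_def flip: g(1) g'(1) of_real_mult)
  also have "\<dots> = (\<Sum>\<kappa>\<in>I. \<Sum>\<eta>\<in>J. C \<kappa> * C' \<eta> * fourier M (- (freq \<kappa> v* A m + freq \<eta> v* A n)))"
    by (simp add: integral_trig_poly_mult fin)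
  also have "norm \<dots> \<le> (\<Sum>\<kappa>\<in>I. \<Sum>\<eta>\<in>J. norm (C \<kappa>) * norm (C' \<eta>) *
      (of_bool (\<eta> = ?Z) * (of_bool (\<kappa> = ?Z) + em) + en))"
  proof (intro sum_norm_le)
    fix \<kappa> \<eta> :: "'d \<Rightarrow> int" assume \<kappa>: "\<kappa> \<in> I" and "\<eta> \<in> J"
    have "norm (fourier M (- (freq \<kappa> v* A m + freq \<eta> v* A n))) \<le>
        of_bool (\<eta> = ?Z) * (of_bool (\<kappa> = ?Z) + em) + en"
    proof (cases "\<eta> = ?Z")
      case False
      have "norm (freq \<kappa>) \<le> K ^ (n - m) / 2"
        using norm_freq_le[of \<kappa> N] \<kappa> deg by (simp add: I_def)
      then show ?thesis using decay2[OF mn _ norm_freq_ge_1[OF False]] False by (simp add: en_def)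
    next
      case True
      then have freq0: "freq \<eta> = 0" by (simp add: vec_eq_iff)
      show ?thesis
      proof (cases "\<kappa> = ?Z")
        case True
        then show ?thesis using \<open>\<eta> = ?Z\<close> e
            norm_fourier_le_1[OF prob_space_axioms, of "- (freq \<kappa> v* A m + freq \<eta> v* A n)"]
          by simp
      next
        case False
        then show ?thesis using decay[OF mn(1) norm_freq_ge_1[OF False]] \<open>\<eta> = ?Z\<close> e freq0
          by (simp add: em_def)
      qed
    qed
    then show "norm (C \<kappa> * C' \<eta> * fourier M (- (freq \<kappa> v* A m + freq \<eta> v* A n))) \<le>
        norm (C \<kappa>) * norm (C' \<eta>) * (of_bool (\<eta> = ?Z) * (of_bool (\<kappa> = ?Z) + em) + en)"
      unfolding norm_mult by (intro mult_left_mono) auto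
  qed
  also have "\<dots> = (\<Sum>\<kappa>\<in>I. norm (C \<kappa>) * ((of_bool (\<kappa> = ?Z) + em) * norm (C' ?Z)
      + (\<Sum>\<eta>\<in>J. norm (C' \<eta>)) * en))"
  proof (intro sum.cong refl)
    fix \<kappa>
    have "(\<Sum>\<eta>\<in>J. norm (C \<kappa>) * norm (C' \<eta>) * (of_bool (\<eta> = ?Z) * (of_bool (\<kappa> = ?Z) + em) + en)) =
      norm (C \<kappa>) * ((\<Sum>\<eta>\<in>J. of_bool (\<eta> = ?Z) * (norm (C' \<eta>) * (of_bool (\<kappa> = ?Z) + em)))
        + (\<Sum>\<eta>\<in>J. norm (C' \<eta>)) * en)"
      by (simp add: sum_distrib_left sum_distrib_right distrib_left sum.distrib mult_ac)
    also have "(\<Sum>\<eta>\<in>J. of_bool (\<eta> = ?Z) * (norm (C' \<eta>) * (of_bool (\<kappa> = ?Z) + em))) =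
        norm (C' ?Z) * (of_bool (\<kappa> = ?Z) + em)"
      using fin Z by (subst sum.remove[of _ ?Z]) auto
    finally show "(\<Sum>\<eta>\<in>J. norm (C \<kappa>) * norm (C' \<eta>) * (of_bool (\<eta> = ?Z) * (of_bool (\<kappa> = ?Z) + em) + en)) =
      norm (C \<kappa>) * ((of_bool (\<kappa> = ?Z) + em) * norm (C' ?Z) + (\<Sum>\<eta>\<in>J. norm (C' \<eta>)) * en)"
      by (simp add: mult.commute)
  qed
  also have "\<dots> = (norm (C ?Z) + (\<Sum>\<kappa>\<in>I. norm (C \<kappa>)) * em) * norm (C' ?Z)
      + (\<Sum>\<kappa>\<in>I. norm (C \<kappa>)) * (\<Sum>\<eta>\<in>J. norm (C' \<eta>)) * en"
  proof -
    have "(\<Sum>\<kappa>\<in>I. of_bool (\<kappa> = ?Z) * norm (C \<kappa>)) = norm (C ?Z)"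
      using fin Z by (subst sum.remove[of _ ?Z]) auto
    moreover have "(\<Sum>\<kappa>\<in>I. norm (C \<kappa>) * ((of_bool (\<kappa> = ?Z) + em) * c + t * en)) =
        (\<Sum>\<kappa>\<in>I. of_bool (\<kappa> = ?Z) * norm (C \<kappa>)) * c + (\<Sum>\<kappa>\<in>I. norm (C \<kappa>)) * em * c
          + (\<Sum>\<kappa>\<in>I. norm (C \<kappa>)) * t * en" for c t :: real
      by (simp add: sum_distrib_left sum_distrib_right distrib_left distrib_right sum.distrib mult_ac)
    ultimately show ?thesis by (simp add: distrib_right)
  qed
  also have "\<dots> \<le> (norm (C ?Z) + (6 + 3 * ln (real N)) ^ CARD('d) * em) * norm (C' ?Z)
      + (6 + 3 * ln (real N)) ^ CARD('d) * (6 + 3 * ln (real N')) ^ CARD('d) * en"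
    using g(5) g'(5) e N unfolding I_def J_def
    by (intro add_mono mult_mono add_left_mono mult_right_mono mult_nonneg_nonneg sum_nonneg zero_le_power add_nonneg_nonneg) auto
  also have "norm (C ?Z) = (\<Prod>i\<in>UNIV. 2 * \<rho> i + 3 / real N)"
    unfolding g(4) norm_of_real using \<rho> by (intro abs_of_nonneg prod_nonneg) (simp add: less_imp_le add_nonneg_nonneg)
  also have "norm (C' ?Z) = (\<Prod>i\<in>UNIV. 2 * \<rho>' i + 3 / real N')"
    unfolding g'(4) norm_of_real using \<rho>' by (intro abs_of_nonneg prod_nonneg) (simp add: less_imp_le add_nonneg_nonneg)
  finally show ?thesis by (simp add: em_def en_def)
qed

end

section \<open>A second-moment criterion\<close>

text \<open>Binary expansion of \<open>v\<close>: clearing its bits from the lowest upwards walks from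
  \<open>v\<close> down to 0, and clearing bit \<open>i\<close> is either no move or crosses one dyadic interval of
  length \<open>2\<^sup>i\<close>, whose position is determined by the higher bits.\<close>
lemma dyadic_chain_bound:
  fixes d :: "nat \<Rightarrow> real"
  assumes d0: "d 0 = 0" and v: "v < 2 ^ r"
  shows "\<bar>d v\<bar> \<le> (\<Sum>i<r. \<bar>d ((2 * (v div 2 ^ Suc i) + 1) * 2 ^ i) - d (2 * (v div 2 ^ Suc i) * 2 ^ i)\<bar>)"
proof -
  have "\<bar>d v - d (v div 2 ^ i * 2 ^ i)\<bar> \<le>
      (\<Sum>k<i. \<bar>d ((2 * (v div 2 ^ Suc k) + 1) * 2 ^ k) - d (2 * (v div 2 ^ Suc k) * 2 ^ k)\<bar>)" for i
  proof (induction i)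
    case (Suc i)
    define q where "q = v div 2 ^ i"
    have q2: "v div 2 ^ Suc i = q div 2" by (simp only: q_def power_Suc2 div_mult2_eq)
    have pow: "q div 2 * 2 ^ Suc i = 2 * (q div 2) * 2 ^ i" by simp
    have "\<bar>d (q * 2 ^ i) - d (q div 2 * 2 ^ Suc i)\<bar> \<le>
        \<bar>d ((2 * (q div 2) + 1) * 2 ^ i) - d (2 * (q div 2) * 2 ^ i)\<bar>"
    proof (cases "even q")
      case True
      then have "2 * (q div 2) = q" by simp
      then show ?thesis unfolding pow by simp
    next
      case False
      then have "2 * (q div 2) + 1 = q" by presburger
      then show ?thesis unfolding pow by simp
    qed
    then show ?case using Suc.IH unfolding sum.lessThan_Suc q2 q_def[symmetric] by linarith
  qed simp
  from this[of r] show ?thesis using v d0 by simp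
qed

lemma AE_bounded_of_summable_nn_integral:
  fixes Y :: "nat \<Rightarrow> 'a \<Rightarrow> real"
  assumes [measurable]: "\<And>r. Y r \<in> borel_measurable M"
    and Y0: "\<And>r x. Y r x \<ge> 0"
    and b: "\<And>r. (\<integral>\<^sup>+x. ennreal (Y r x) \<partial>M) \<le> ennreal (b r)" "\<And>r. b r \<ge> 0" "summable b"
  shows "AE x in M. \<exists>C\<ge>0. \<forall>r. Y r x \<le> C"
proof -
  have "(\<integral>\<^sup>+x. (\<Sum>r. ennreal (Y r x)) \<partial>M) = (\<Sum>r. \<integral>\<^sup>+x. ennreal (Y r x) \<partial>M)"
    by (intro nn_integral_suminf) measurable
  also have "\<dots> \<le> (\<Sum>r. ennreal (b r))" by (intro suminf_le b) auto
  also have "\<dots> = ennreal (\<Sum>r. b r)" using b by (intro suminf_ennreal2) auto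
  also have "\<dots> < \<infinity>" by simp
  finally have "(\<integral>\<^sup>+x. (\<Sum>r. ennreal (Y r x)) \<partial>M) \<noteq> \<infinity>" by simp
  then have "AE x in M. (\<Sum>r. ennreal (Y r x)) \<noteq> \<infinity>"
    by (intro nn_integral_PInf_AE) auto
  then show ?thesis
  proof (rule AE_mp, intro AE_I2 impI)
    fix x assume fin: "(\<Sum>r. ennreal (Y r x)) \<noteq> \<infinity>"
    define C where "C = enn2real (\<Sum>r. ennreal (Y r x))"
    have "Y r x \<le> C" for r
    proof -
      have "ennreal (Y r x) = (\<Sum>k\<in>{r}. ennreal (Y k x))" by simp
      also have "\<dots> \<le> (\<Sum>r. ennreal (Y r x))" by (intro sum_le_suminf) auto
      also have "\<dots> = ennreal C" using fin by (simp add: C_def less_top)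
      finally show ?thesis by (simp add: C_def)
    qed
    then show "\<exists>C\<ge>0. \<forall>r. Y r x \<le> C" by (intro exI[of _ C]) (simp add: C_def)
  qed
qed

text \<open>A second-moment criterion of Gal--Koksma type, with the error measured in the clock
  \<open>\<Phi>\<close> and not in \<open>N\<close>. Let \<open>\<tau> v\<close> be the time at which \<open>\<Phi>\<close> is
  about to reach the level \<open>v\<close>. The sums over the blocks between levels \<open>h 2\<^sup>i\<close>
  and \<open>(h + 1) 2\<^sup>i\<close> have second moment \<open>O(2\<^sup>i)\<close>. For each \<open>r\<close> the squares
  of all blocks below level \<open>2\<^sup>r\<close> add up, in mean, to \<open>O((r + 1) 2\<^sup>r)\<close>;
  dividing by \<open>w r = 2\<^sup>r (r + 1) powr (2 + 2 \<epsilon>)\<close> makes this summable in \<open>r\<close>, so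
  almost surely every such block is \<open>O(sqrt (w r))\<close>. A sum up to a level below
  \<open>2\<^sup>r\<close> consists of at most \<open>r\<close> dyadic blocks, which costs the last factor
  \<open>r\<close>. Between consecutive levels the partial sums are squeezed by monotonicity, since
  \<open>f\<close> is nonnegative and \<open>\<psi>\<close> gains at most \<open>1 + c\<close> there.\<close>
lemma strong_law_of_variance_bound:
  fixes f :: "nat \<Rightarrow> 'a \<Rightarrow> real" and \<psi> \<phi> :: "nat \<Rightarrow> real" and \<Phi> :: "nat \<Rightarrow> real"
  defines "\<Phi> N \<equiv> \<Sum>n=1..N. \<phi> n"
  assumes f [measurable]: "\<And>n. f n \<in> borel_measurable M" and f0: "\<And>n x. f n x \<ge> 0"
    and \<psi>: "\<And>n. n \<ge> 1 \<Longrightarrow> 0 \<le> \<psi> n \<and> \<psi> n \<le> \<phi> n \<and> \<phi> n \<le> c"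
    and var: "\<And>a b. a < b \<Longrightarrow>
      (\<integral>\<^sup>+x. ennreal ((\<Sum>n\<in>{a<..b}. f n x - \<psi> n)\<^sup>2) \<partial>M) \<le> ennreal (B * (\<Sum>n\<in>{a<..b}. \<phi> n))"
    and B: "B \<ge> 0" and c: "c \<ge> 0" and \<epsilon>: "\<epsilon> > 0"
    and unbounded: "\<And>v. \<exists>n. \<Phi> n \<ge> v"
  shows "AE x in M. \<exists>C\<ge>0. \<forall>N\<ge>1. \<bar>\<Sum>n=1..N. f n x - \<psi> n\<bar> \<le>
    C * (sqrt (\<Phi> N + 1) * ln (\<Phi> N + 2) powr (2 + \<epsilon>))"
proof -
  define S where "S N x = (\<Sum>n=1..N. f n x - \<psi> n)" for N x
  define \<tau> where "\<tau> v = (LEAST n. \<Phi> (Suc n) \<ge> real v)" for v :: nat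
  define Z where "Z i h x = S (\<tau> ((h + 1) * 2 ^ i)) x - S (\<tau> (h * 2 ^ i)) x" for i h x
  have \<phi>0: "\<phi> n \<ge> 0" "\<phi> n \<le> c" if "n \<ge> 1" for n using \<psi>[OF that] by auto
  have \<Phi>0: "\<Phi> 0 = 0" by (simp add: \<Phi>_def)
  have split: "(\<Sum>n=1..N'. g n) - (\<Sum>n=1..N. g n) = (\<Sum>n\<in>{N<..N'}. g n)" if "N \<le> N'"
    for g :: "nat \<Rightarrow> real" and N N'
  proof -
    have "{1..N'} = {1..N} \<union> {N<..N'}" using that by auto
    then have "(\<Sum>n=1..N'. g n) = (\<Sum>n=1..N. g n) + (\<Sum>n\<in>{N<..N'}. g n)"
      by (simp only:) (intro sum.union_disjoint, auto)
    then show ?thesis by simp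
  qed
  have \<Phi>_mono: "\<Phi> N \<le> \<Phi> N'" if "N \<le> N'" for N N'
  proof -
    have "\<Phi> N' - \<Phi> N \<ge> 0"
      unfolding \<Phi>_def split[OF that] by (intro sum_nonneg \<phi>0) auto
    then show ?thesis by simp
  qed
  \<comment> \<open>at time \<open>\<tau> v\<close> the clock has not passed \<open>v\<close>, and its next step of size at most \<open>c\<close> reaches it\<close>
  have \<tau>1: "\<Phi> (Suc (\<tau> v)) \<ge> real v" for v
  proof -
    obtain n where "\<Phi> n \<ge> real v" using unbounded by blast
    then have "\<Phi> (Suc n) \<ge> real v" using \<Phi>_mono[of n "Suc n"] by simp
    then show ?thesis unfolding \<tau>_def by (rule LeastI)
  qed
  have \<tau>2: "\<Phi> (\<tau> v) \<le> real v" for v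
  proof (cases "\<tau> v")
    case 0
    then show ?thesis by (simp add: \<Phi>0)
  next
    case (Suc k)
    then have "\<not> \<Phi> (Suc k) \<ge> real v"
      using not_less_Least[of k "\<lambda>n. \<Phi> (Suc n) \<ge> real v"] by (simp add: \<tau>_def)
    then show ?thesis using Suc by simp
  qed
  have \<tau>3: "\<Phi> (\<tau> v) \<ge> real v - c" for v
    using \<tau>1[of v] \<phi>0(2)[of "Suc (\<tau> v)"] by (simp add: \<Phi>_def)
  have \<tau>_le: "\<tau> v \<le> N" if "N \<ge> 1" "real v \<le> \<Phi> N" for v N
    using Least_le[of "\<lambda>n. \<Phi> (Suc n) \<ge> real v" "N - 1"] that by (simp add: \<tau>_def)
  have \<tau>_ge: "N \<le> \<tau> v" if "\<Phi> N < real v" for v N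
    using \<Phi>_mono[of "Suc (\<tau> v)" N] \<tau>1[of v] that by (cases "N \<le> \<tau> v") auto
  have \<tau>_mono: "\<tau> u \<le> \<tau> v" if "u \<le> v" for u v
    unfolding \<tau>_def[of u] using \<tau>1[of v] that by (intro Least_le) simp
  have \<tau>0: "\<tau> 0 = 0" using \<phi>0[of 1] by (simp add: \<tau>_def \<Phi>_def)
  have [measurable]: "S N \<in> borel_measurable M" for N unfolding S_def[abs_def] by measurable
  have [measurable]: "Z i h \<in> borel_measurable M" for i h unfolding Z_def[abs_def] by measurable
  define B' where "B' = B * (1 + c)"
  have B': "B' \<ge> 0" using B c by (simp add: B'_def)
  have Z: "(\<integral>\<^sup>+x. ennreal ((Z i h x)\<^sup>2) \<partial>M) \<le> ennreal (B' * 2 ^ i)" for i h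
  proof -
    define a where "a = \<tau> (h * 2 ^ i)"
    define b where "b = \<tau> ((h + 1) * 2 ^ i)"
    have ab: "a \<le> b" unfolding a_def b_def by (intro \<tau>_mono) simp
    have Zeq: "Z i h x = (\<Sum>n\<in>{a<..b}. f n x - \<psi> n)" for x
      unfolding Z_def S_def a_def[symmetric] b_def[symmetric] by (rule split[OF ab])
    show ?thesis
    proof (cases "a = b")
      case True
      then show ?thesis unfolding Zeq using B' by simp
    next
      case False
      then have "(\<integral>\<^sup>+x. ennreal ((Z i h x)\<^sup>2) \<partial>M) \<le> ennreal (B * (\<Phi> b - \<Phi> a))"
        unfolding Zeq \<Phi>_def split[OF ab] using ab by (intro var) simp
      also have "\<Phi> b - \<Phi> a \<le> 2 ^ i + c"
        using \<tau>2[of "(h + 1) * 2 ^ i"] \<tau>3[of "h * 2 ^ i"]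
        by (simp add: a_def b_def algebra_simps)
      also have "2 ^ i + c \<le> (1 + c) * 2 ^ i"
        using c mult_left_mono[of 1 "2 ^ i" c] by (simp add: algebra_simps)
      finally show ?thesis using B by (simp add: B'_def mult.assoc ennreal_leI mult_left_mono)
    qed
  qed
  define w where "w r = 2 ^ r * real (Suc r) powr (2 + 2 * \<epsilon>)" for r
  have w: "w r > 0" for r by (simp add: w_def)
  define Y where "Y r x = (\<Sum>i\<le>r. \<Sum>h<2 ^ (r - i). (Z i h x)\<^sup>2) / w r" for r x
  have "AE x in M. \<exists>C\<ge>0. \<forall>r. Y r x \<le> C"
  proof (rule AE_bounded_of_summable_nn_integral)
    show "Y r \<in> borel_measurable M" for r unfolding Y_def[abs_def] by measurable
    show "Y r x \<ge> 0" for r x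
      unfolding Y_def using w[of r] by (intro divide_nonneg_nonneg sum_nonneg) auto
    show "(\<integral>\<^sup>+x. ennreal (Y r x) \<partial>M) \<le> ennreal (B' * real (Suc r) powr (- 1 - 2 * \<epsilon>))" for r
    proof -
      have "(\<integral>\<^sup>+x. ennreal (Y r x) \<partial>M) =
          (\<integral>\<^sup>+x. (\<Sum>i\<le>r. \<Sum>h<2 ^ (r - i). ennreal ((Z i h x)\<^sup>2)) * ennreal (1 / w r) \<partial>M)"
        using w[of r] by (intro nn_integral_cong)
          (simp add: Y_def sum_ennreal sum_nonneg flip: ennreal_mult)
      also have "\<dots> = (\<Sum>i\<le>r. \<Sum>h<2 ^ (r - i). \<integral>\<^sup>+x. ennreal ((Z i h x)\<^sup>2) \<partial>M) * ennreal (1 / w r)"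
        by (simp add: nn_integral_multc nn_integral_sum del: sum_ennreal)
      also have "\<dots> \<le> (\<Sum>i\<le>r. \<Sum>h<(2::nat) ^ (r - i). ennreal (B' * 2 ^ i)) * ennreal (1 / w r)"
        by (intro mult_right_mono sum_mono Z) auto
      also have "\<dots> = ennreal ((\<Sum>i\<le>r. \<Sum>h<(2::nat) ^ (r - i). B' * 2 ^ i) * (1 / w r))"
        using B' w[of r] by (simp add: sum_ennreal sum_nonneg flip: ennreal_mult del: sum_constant)
      also have "(\<Sum>i\<le>r. \<Sum>h<(2::nat) ^ (r - i). B' * 2 ^ i) = (\<Sum>i\<le>r. B' * 2 ^ r)"
        by (intro sum.cong refl) (simp add: mult_ac flip: power_add)
      also have "\<dots> * (1 / w r) = B' * (real (Suc r) / real (Suc r) powr (2 + 2 * \<epsilon>))"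
        by (simp add: w_def field_simps)
      also have "real (Suc r) / real (Suc r) powr (2 + 2 * \<epsilon>) = real (Suc r) powr (- 1 - 2 * \<epsilon>)"
        using powr_diff[of "real (Suc r)" 1 "2 + 2 * \<epsilon>"] by simp
      finally show ?thesis .
    qed
    show "B' * real (Suc r) powr (- 1 - 2 * \<epsilon>) \<ge> 0" for r using B' by simp
    have "summable (\<lambda>n. real n powr (- 1 - 2 * \<epsilon>))"
      using \<epsilon> by (simp add: summable_real_powr_iff)
    then have "summable (\<lambda>r. real (Suc r) powr (- 1 - 2 * \<epsilon>))"
      by (subst summable_Suc_iff)
    then show "summable (\<lambda>r. B' * real (Suc r) powr (- 1 - 2 * \<epsilon>))" by (rule summable_mult)
  qed
  then show ?thesis
  proof (rule AE_mp, intro AE_I2 impI)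
    fix x assume "\<exists>C\<ge>0. \<forall>r. Y r x \<le> C"
    then obtain C where C: "C \<ge> 0" "\<And>r. Y r x \<le> C" by blast
    have Zle: "\<bar>Z i h x\<bar> \<le> sqrt (C * w r)" if "i \<le> r" "h < 2 ^ (r - i)" for i h r
    proof -
      have "(Z i h x)\<^sup>2 \<le> (\<Sum>h<2 ^ (r - i). (Z i h x)\<^sup>2)"
        using that by (intro member_le_sum) auto
      also have "\<dots> \<le> (\<Sum>i\<le>r. \<Sum>h<2 ^ (r - i). (Z i h x)\<^sup>2)"
        using that by (intro member_le_sum[of i "{..r}" "\<lambda>i. \<Sum>h<2 ^ (r - i). (Z i h x)\<^sup>2"] sum_nonneg) auto
      also have "\<dots> \<le> C * w r"
        using C(2)[of r] w[of r] by (simp add: Y_def pos_divide_le_eq)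
      finally have "sqrt ((Z i h x)\<^sup>2) \<le> sqrt (C * w r)" by (rule real_sqrt_le_mono)
      then show ?thesis by simp
    qed
    have level: "\<bar>S (\<tau> v) x\<bar> \<le> sqrt C * (sqrt (2 ^ r) * real (Suc r) powr (2 + \<epsilon>))"
      if v: "v < 2 ^ r" for v r
    proof -
      have "\<bar>S (\<tau> v) x\<bar> \<le> (\<Sum>i<r. \<bar>Z i (2 * (v div 2 ^ Suc i)) x\<bar>)"
        using dyadic_chain_bound[of "\<lambda>v. S (\<tau> v) x" v r] v \<tau>0 by (simp add: Z_def S_def)
      also have "\<dots> \<le> (\<Sum>i<r. sqrt (C * w r))"
      proof (intro sum_mono Zle)
        fix i assume "i \<in> {..<r}"
        then have i: "i < r" by simp
        then show "i \<le> r" by simp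
        have "v < 2 ^ (r - Suc i) * 2 ^ Suc i" using v i by (simp flip: power_add power_Suc)
        then have "v div 2 ^ Suc i < 2 ^ (r - Suc i)" by (simp add: less_mult_imp_div_less)
        moreover have "(2::nat) ^ (r - i) = 2 * 2 ^ (r - Suc i)"
          using i by (simp flip: power_Suc add: Suc_diff_Suc)
        ultimately show "2 * (v div 2 ^ Suc i) < 2 ^ (r - i)" by simp
      qed
      also have "\<dots> = real r * sqrt (C * w r)" by simp
      also have "\<dots> \<le> real (Suc r) * sqrt (C * w r)"
        using C w[of r] by (intro mult_right_mono) auto
      also have "sqrt (C * w r) = sqrt C * (sqrt (2 ^ r) * real (Suc r) powr (1 + \<epsilon>))"
      proof -
        have "sqrt (real (Suc r) powr (2 + 2 * \<epsilon>)) = real (Suc r) powr (1 + \<epsilon>)"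
          by (simp add: powr_half_sqrt[symmetric] powr_powr add_divide_distrib)
        then show ?thesis by (simp add: w_def real_sqrt_mult)
      qed
      also have "real (Suc r) * \<dots> = sqrt C * (sqrt (2 ^ r) * (real (Suc r) powr 1 * real (Suc r) powr (1 + \<epsilon>)))"
        by simp
      also have "real (Suc r) powr 1 * real (Suc r) powr (1 + \<epsilon>) = real (Suc r) powr (2 + \<epsilon>)"
        by (simp only: powr_add[symmetric]) simp
      finally show ?thesis .
    qed
    define C' where "C' = (sqrt (2 * C) + 1 + c) * 5 powr (2 + \<epsilon>)"
    have "\<bar>S N x\<bar> \<le> C' * (sqrt (\<Phi> N + 1) * ln (\<Phi> N + 2) powr (2 + \<epsilon>))" if N: "N \<ge> 1" for N
    proof -
      define v where "v = nat \<lfloor>\<Phi> N\<rfloor>"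
      have \<Phi>N: "\<Phi> N \<ge> 0" using \<Phi>_mono[of 0 N] \<Phi>0 by simp
      have v: "real v \<le> \<Phi> N" "\<Phi> N < real (v + 1)"
      proof -
        have "real v = of_int \<lfloor>\<Phi> N\<rfloor>" using \<Phi>N by (simp add: v_def)
        then show "real v \<le> \<Phi> N" "\<Phi> N < real (v + 1)" by linarith+
      qed
      obtain k where k: "2 ^ k \<le> v + 1" "v + 1 < 2 ^ Suc k"
        using ex_power_ivl1[of 2 "v + 1"] by auto
      define L where "L = 5 * ln (\<Phi> N + 2)"
      have pow: "2 ^ Suc k \<le> 2 * (\<Phi> N + 1)"
      proof -
        have "real (2 ^ k) \<le> real (v + 1)" using k(1) by (simp only: of_nat_le_iff)
        then show ?thesis using v by simp
      qed
      have L: "real (Suc (Suc k)) \<le> L"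
      proof -
        have "real k * ln 2 = ln (2 ^ k)" by (simp add: ln_realpow)
        also have "\<dots> \<le> ln (\<Phi> N + 2)" using pow \<Phi>N by (subst ln_le_cancel_iff) auto
        finally have "real k * ln 2 \<le> ln (\<Phi> N + 2)" .
        moreover have "real k * (2 / 3) \<le> real k * ln 2"
          using ln2_ge_two_thirds by (intro mult_left_mono) auto
        moreover have "ln 2 \<le> ln (\<Phi> N + 2)" using \<Phi>N by simp
        moreover have "(2 / 3 :: real) \<le> ln 2" using ln2_ge_two_thirds by simp
        ultimately show ?thesis unfolding L_def of_nat_Suc by linarith
      qed
      define Q where "Q = sqrt (2 * C) * (sqrt (\<Phi> N + 1) * L powr (2 + \<epsilon>))"
      have Sle: "\<bar>S (\<tau> u) x\<bar> \<le> Q" if "u \<le> v + 1" for u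
      proof -
        have "u < 2 ^ Suc k" using that k(2) by linarith
        from level[OF this] have "\<bar>S (\<tau> u) x\<bar> \<le> sqrt C * (sqrt (2 ^ Suc k) * real (Suc (Suc k)) powr (2 + \<epsilon>))" .
        also have "\<dots> \<le> sqrt C * (sqrt (2 * (\<Phi> N + 1)) * L powr (2 + \<epsilon>))"
          using C \<epsilon> pow L \<Phi>N by (intro mult_left_mono mult_mono powr_mono2 real_sqrt_le_mono) auto
        also have "\<dots> = Q" by (simp only: Q_def real_sqrt_mult mult.assoc mult.left_commute)
        finally show ?thesis .
      qed
      have \<psi>\<phi>: "(\<Sum>n\<in>{a<..b}. \<psi> n) \<le> \<Phi> b - \<Phi> a" if "a \<le> b" for a b
        unfolding \<Phi>_def split[OF that] using \<psi> by (intro sum_mono) auto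
      have "S N x \<le> Q + 1"
      proof -
        have le: "N \<le> \<tau> (v + 1)" using v by (intro \<tau>_ge) simp
        have "S (\<tau> (v + 1)) x - S N x = (\<Sum>n\<in>{N<..\<tau> (v + 1)}. f n x - \<psi> n)"
          unfolding S_def by (rule split[OF le])
        also have "\<dots> \<ge> - (\<Sum>n\<in>{N<..\<tau> (v + 1)}. \<psi> n)"
          by (simp add: sum_subtractf sum_nonneg f0)
        finally have "S N x \<le> S (\<tau> (v + 1)) x + (\<Sum>n\<in>{N<..\<tau> (v + 1)}. \<psi> n)" by simp
        moreover have "\<Phi> (\<tau> (v + 1)) - \<Phi> N \<le> 1" using \<tau>2[of "v + 1"] v by simp
        ultimately show ?thesis using Sle[of "v + 1"] \<psi>\<phi>[OF le] by linarith
      qed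
      moreover have "S N x \<ge> - (Q + 1 + c)"
      proof -
        have le: "\<tau> v \<le> N" using v N by (intro \<tau>_le) auto
        have "S N x - S (\<tau> v) x = (\<Sum>n\<in>{\<tau> v<..N}. f n x - \<psi> n)"
          unfolding S_def by (rule split[OF le])
        also have "\<dots> \<ge> - (\<Sum>n\<in>{\<tau> v<..N}. \<psi> n)"
          by (simp add: sum_subtractf sum_nonneg f0)
        finally have "S N x \<ge> S (\<tau> v) x - (\<Sum>n\<in>{\<tau> v<..N}. \<psi> n)" by simp
        moreover have "\<Phi> N - \<Phi> (\<tau> v) \<le> 1 + c" using \<tau>3[of v] v by simp
        ultimately show ?thesis using Sle[of v] \<psi>\<phi>[OF le] by linarith
      qed
      ultimately have "\<bar>S N x\<bar> \<le> Q + (1 + c) * 1" using c by (simp add: abs_le_iff)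
      also have "\<dots> \<le> Q + (1 + c) * (sqrt (\<Phi> N + 1) * L powr (2 + \<epsilon>))"
      proof (intro add_left_mono mult_left_mono)
        have "1 \<le> L powr (2 + \<epsilon>)" using L \<epsilon> by (intro ge_one_powr_ge_zero) auto
        then have "1 * 1 \<le> sqrt (\<Phi> N + 1) * L powr (2 + \<epsilon>)"
          using \<Phi>N by (intro mult_mono) auto
        then show "1 \<le> sqrt (\<Phi> N + 1) * L powr (2 + \<epsilon>)" by simp
      qed (use c in auto)
      also have "\<dots> = (sqrt (2 * C) + 1 + c) * (sqrt (\<Phi> N + 1) * L powr (2 + \<epsilon>))"
        by (simp add: Q_def algebra_simps)
      also have "L powr (2 + \<epsilon>) = 5 powr (2 + \<epsilon>) * ln (\<Phi> N + 2) powr (2 + \<epsilon>)"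
        unfolding L_def by (rule powr_mult)
      finally show ?thesis by (simp add: C'_def mult_ac)
    qed
    moreover have "C' \<ge> 0" using C c by (simp add: C'_def)
    ultimately show "\<exists>C\<ge>0. \<forall>N\<ge>1. \<bar>\<Sum>n=1..N. f n x - \<psi> n\<bar> \<le>
        C * (sqrt (\<Phi> N + 1) * ln (\<Phi> N + 2) powr (2 + \<epsilon>))"
      unfolding S_def by blast
  qed
qed

section \<open>Variance of counts of nearly independent events\<close>

text \<open>The variance of the number of occurrences in a block is at most a constant times the sum
  of \<open>\<psi> n + e n\<close> over it. The excess of the correlation over \<open>\<psi> m * \<psi> n\<close> is
  dominated by four kinds of terms: \<open>\<phi> m * e n\<close>, \<open>\<phi> n * e m\<close>,
  \<open>\<phi> n / (n - m)\<^sup>2\<close> and \<open>\<phi> n / n\<close>. Each has the form of one \<open>\<phi>\<close> times a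
  factor whose sum over the other index is bounded independently of the block, so nothing is
  lost to the length of the block.\<close>
lemma (in prob_space) variance_bound_of_quasi_independence:
  fixes E :: "nat \<Rightarrow> 'a set" and \<psi> e :: "nat \<Rightarrow> real"
  assumes E [measurable]: "\<And>n. E n \<in> events"
    and \<psi>: "\<And>n. n \<ge> 1 \<Longrightarrow> 0 \<le> \<psi> n \<and> \<psi> n \<le> 1"
    and e: "\<And>n. e n \<ge> 0" "summable e" and C: "C \<ge> 0"
    and single: "\<And>n. n \<ge> 1 \<Longrightarrow> \<bar>prob (E n) - \<psi> n\<bar> \<le> C * e n"
    and pair: "\<And>m n. 1 \<le> m \<Longrightarrow> m < n \<Longrightarrow> prob (E m \<inter> E n) \<le>
      (\<psi> m + C * (1 / real (n - m) ^ 2 + e m)) * (\<psi> n + C * e n) + C * e n / real n"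
  obtains B where "B \<ge> 0"
    "\<And>a b. (\<integral>\<^sup>+x. ennreal ((\<Sum>n\<in>{a<..b}. indicator (E n) x - \<psi> n)\<^sup>2) \<partial>M)
       \<le> ennreal (B * (\<Sum>n\<in>{a<..b}. \<psi> n + e n))"
proof -
  define \<phi> where "\<phi> n = \<psi> n + e n" for n
  define H where "H = (\<Sum>n. e n)"
  define \<zeta> where "\<zeta> = (\<Sum>n. 1 / real n ^ 2)"
  define G where "G = C * (C + 3)"
  define B where "B = 2 * (G * (2 * H + \<zeta> + 1)) + (2 + C)"
  have sq: "summable (\<lambda>n. 1 / real n ^ 2)"
    using inverse_power_summable[of 2, where 'a = real] by (simp add: inverse_eq_divide)
  have H: "H \<ge> 0" "\<And>I. finite I \<Longrightarrow> sum e I \<le> H"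
    using e by (auto simp: H_def intro!: suminf_nonneg sum_le_suminf)
  have \<zeta>: "\<zeta> \<ge> 0" "\<And>I. finite I \<Longrightarrow> (\<Sum>n\<in>I. 1 / real n ^ 2) \<le> \<zeta>"
    using sq by (auto simp: \<zeta>_def intro!: suminf_nonneg sum_le_suminf)
  have G: "G \<ge> 0" using C by (simp add: G_def)
  have B: "B \<ge> 0" using C G H \<zeta> by (simp add: B_def)
  define cov where "cov m n = prob (E m \<inter> E n) - \<psi> m * prob (E n) - \<psi> n * prob (E m) + \<psi> m * \<psi> n" for m n
  \<comment> \<open>bound for the covariance above the diagonal; below it, symmetry is used\<close>
  define g where "g m n = (if m < n then G * (\<phi> m * e n + \<phi> n * (1 / real (n - m) ^ 2 + e m + 1 / real n)) else 0)" for m n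
  have \<phi>: "\<phi> n \<ge> 0" "\<psi> n \<le> \<phi> n" "e n \<le> \<phi> n" if "n \<ge> 1" for n
    using \<psi>[OF that] e(1)[of n] by (auto simp: \<phi>_def)
  have cov_off: "cov m n \<le> g m n" if mn: "1 \<le> m" "m < n" for m n
  proof -
    define j where "j = 1 / real (n - m) ^ 2"
    have n: "n \<ge> 1" using mn by simp
    have j: "j \<ge> 0" by (simp add: j_def)
    have "\<psi> m * (\<psi> n - C * e n) \<le> \<psi> m * prob (E n)"
      using single[OF n] \<psi>[OF mn(1)] by (intro mult_left_mono) linarith+
    moreover have "\<psi> n * (\<psi> m - C * e m) \<le> \<psi> n * prob (E m)"
      using single[OF mn(1)] \<psi>[OF n] by (intro mult_left_mono) linarith+
    moreover note pair[OF mn]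
    ultimately have "cov m n \<le> (\<psi> m + C * (j + e m)) * (\<psi> n + C * e n) + C * e n / real n
        - \<psi> m * (\<psi> n - C * e n) - \<psi> n * (\<psi> m - C * e m) + \<psi> m * \<psi> n"
      unfolding cov_def j_def by linarith
    also have "\<dots> = 2 * C * (\<psi> m * e n) + C * ((j + e m) * (\<psi> n + C * e n))
        + C * (e n * (1 / real n)) + C * (\<psi> n * e m)"
      by (simp add: algebra_simps)
    also have "\<dots> \<le> 2 * C * (\<phi> m * e n) + C * ((j + e m) * (\<phi> n + C * \<phi> n))
        + C * (\<phi> n * (1 / real n)) + C * (\<phi> n * e m)"
      using C e(1) j \<phi>[OF n] \<phi>[OF mn(1)]
      by (intro add_mono mult_left_mono mult_right_mono) auto
    also have "\<dots> = 2 * C * (\<phi> m * e n) + C * (C + 1) * (\<phi> n * j) + C * (C + 2) * (\<phi> n * e m)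
        + C * (\<phi> n * (1 / real n))"
      by (simp add: algebra_simps)
    also have "\<dots> \<le> G * (\<phi> m * e n) + G * (\<phi> n * j) + G * (\<phi> n * e m) + G * (\<phi> n * (1 / real n))"
    proof -
      have "2 * C \<le> G" "C * (C + 1) \<le> G" "C * (C + 2) \<le> G" "C \<le> G"
        using C by (auto simp: G_def algebra_simps)
      then show ?thesis
        using e(1) j \<phi>[OF n] \<phi>[OF mn(1)] by (intro add_mono mult_right_mono mult_nonneg_nonneg) auto
    qed
    also have "\<dots> = g m n" using mn by (simp add: g_def j_def algebra_simps)
    finally show ?thesis .
  qed
  have cov_sym: "cov m n = cov n m" for m n by (simp add: cov_def Int_commute)
  have cov_diag: "cov n n \<le> (2 + C) * \<phi> n" if n: "n \<ge> 1" for n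
  proof -
    have "cov n n \<le> prob (E n) + \<psi> n * \<psi> n" using \<psi>[OF n] by (simp add: cov_def)
    also have "\<psi> n * \<psi> n \<le> \<psi> n * 1" using \<psi>[OF n] by (intro mult_left_mono) auto
    also have "prob (E n) \<le> \<psi> n + C * e n" using single[OF n] by linarith
    also have "\<psi> n + C * e n + \<psi> n * 1 = 2 * \<psi> n + C * e n" by simp
    also have "\<dots> \<le> 2 * \<phi> n + C * \<phi> n"
      using C \<phi>[OF n] by (intro add_mono mult_left_mono) auto
    finally show ?thesis by (simp add: distrib_right)
  qed
  have "(\<integral>\<^sup>+x. ennreal ((\<Sum>n\<in>{a<..b}. indicator (E n) x - \<psi> n)\<^sup>2) \<partial>M)
       \<le> ennreal (B * (\<Sum>n\<in>{a<..b}. \<phi> n))" for a b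
  proof -
    define I where "I = {a<..b}"
    have finI: "finite I" and I1: "\<And>n. n \<in> I \<Longrightarrow> n \<ge> 1" by (auto simp: I_def)
    have expand: "(\<Sum>n\<in>I. indicator (E n) x - \<psi> n)\<^sup>2 = (\<Sum>m\<in>I. \<Sum>n\<in>I.
        indicator (E m \<inter> E n) x - \<psi> m * indicator (E n) x - \<psi> n * indicator (E m) x + \<psi> m * \<psi> n)" for x
      by (simp add: power2_eq_square sum_product algebra_simps indicator_inter_arith)
    have int: "integrable M (\<lambda>x. indicator F x :: real)" if "F \<in> events" for F
      using that by (simp add: emeasure_eq_measure)
    have intprod: "integrable M (\<lambda>x. (\<Sum>n\<in>I. indicator (E n) x - \<psi> n)\<^sup>2)"
      unfolding expand by (intro Bochner_Integration.integrable_sum Bochner_Integration.integrable_add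
        Bochner_Integration.integrable_diff integrable_mult_right int) auto
    have "(LINT x|M. (\<Sum>n\<in>I. indicator (E n) x - \<psi> n)\<^sup>2) = (\<Sum>m\<in>I. \<Sum>n\<in>I. cov m n)"
      unfolding expand cov_def
      by (simp add: int prob_space Bochner_Integration.integral_sum)
    also have "\<dots> \<le> (\<Sum>m\<in>I. \<Sum>n\<in>I. g m n + g n m + of_bool (m = n) * ((2 + C) * \<phi> n))"
    proof (intro sum_mono)
      fix m n assume "m \<in> I" "n \<in> I"
      then have "m \<ge> 1" "n \<ge> 1" using I1 by auto
      then show "cov m n \<le> g m n + g n m + of_bool (m = n) * ((2 + C) * \<phi> n)"
        using cov_off[of m n] cov_off[of n m] cov_sym[of m n] cov_diag[of n]
        by (cases m n rule: linorder_cases) (auto simp: g_def)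
    qed
    also have "\<dots> = 2 * (\<Sum>n\<in>I. \<Sum>m\<in>I. g m n) + (2 + C) * (\<Sum>n\<in>I. \<phi> n)"
    proof -
      have "(\<Sum>m\<in>I. \<Sum>n\<in>I. of_bool (m = n) * ((2 + C) * \<phi> n)) = (\<Sum>m\<in>I. (2 + C) * \<phi> m)"
      proof (intro sum.cong refl)
        fix m assume "m \<in> I"
        then show "(\<Sum>n\<in>I. of_bool (m = n) * ((2 + C) * \<phi> n)) = (2 + C) * \<phi> m"
          using finI by (subst sum.remove[of _ m]) auto
      qed
      moreover have "(\<Sum>m\<in>I. \<Sum>n\<in>I. g m n) = (\<Sum>n\<in>I. \<Sum>m\<in>I. g m n)" by (rule sum.swap)
      ultimately show ?thesis by (simp add: sum.distrib sum_distrib_left)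
    qed
    also have "(\<Sum>n\<in>I. \<Sum>m\<in>I. g m n) \<le> G * (2 * H + \<zeta> + 1) * (\<Sum>n\<in>I. \<phi> n)"
    proof -
      have "(\<Sum>n\<in>I. \<Sum>m\<in>I. g m n) \<le>
        (\<Sum>n\<in>I. \<Sum>m\<in>I. G * (\<phi> m * e n)) + (\<Sum>n\<in>I. G * \<phi> n * (\<zeta> + H + 1))"
        unfolding sum.distrib[symmetric]
      proof (rule sum_mono)
        fix n assume nI: "n \<in> I"
        then have n: "n \<ge> 1" by (rule I1)
        have "(\<Sum>m\<in>I. g m n) \<le> (\<Sum>m\<in>I. G * (\<phi> m * e n) +
            G * \<phi> n * (if m < n then 1 / real (n - m) ^ 2 + e m + 1 / real n else 0))"
        proof (rule sum_mono)
          fix m assume "m \<in> I"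
          then show "g m n \<le> G * (\<phi> m * e n) +
            G * \<phi> n * (if m < n then 1 / real (n - m) ^ 2 + e m + 1 / real n else 0)"
            using G e(1) \<phi>(1)[OF I1] by (simp add: g_def algebra_simps)
        qed
        also have "\<dots> = (\<Sum>m\<in>I. G * (\<phi> m * e n)) +
            G * \<phi> n * (\<Sum>m\<in>I. if m < n then 1 / real (n - m) ^ 2 + e m + 1 / real n else 0)"
          by (simp add: sum.distrib sum_distrib_left)
        also have "(\<Sum>m\<in>I. if m < n then 1 / real (n - m) ^ 2 + e m + 1 / real n else 0) =
            (\<Sum>m\<in>{m\<in>I. m < n}. 1 / real (n - m) ^ 2 + e m + 1 / real n)"
          by (rule sum.inter_filter[OF finI, symmetric])
        also have "\<dots> = (\<Sum>m\<in>{m\<in>I. m < n}. 1 / real (n - m) ^ 2) + (\<Sum>m\<in>{m\<in>I. m < n}. e m)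
            + real (card {m\<in>I. m < n}) / real n"
          by (simp only: sum.distrib sum_constant) simp
        also have "\<dots> \<le> \<zeta> + H + 1"
        proof (intro add_mono)
          have "(\<Sum>m\<in>{m\<in>I. m < n}. 1 / real (n - m) ^ 2) = (\<Sum>j\<in>(\<lambda>m. n - m) ` {m\<in>I. m < n}. 1 / real j ^ 2)"
            by (subst sum.reindex) (auto simp: inj_on_def)
          also have "\<dots> \<le> \<zeta>" using finI by (intro \<zeta>) auto
          finally show "(\<Sum>m\<in>{m\<in>I. m < n}. 1 / real (n - m) ^ 2) \<le> \<zeta>" .
          show "(\<Sum>m\<in>{m\<in>I. m < n}. e m) \<le> H" using finI by (intro H) auto
          have "card {m\<in>I. m < n} \<le> card {..<n}" by (intro card_mono) auto
          then show "real (card {m\<in>I. m < n}) / real n \<le> 1" using n by simp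
        qed
        finally show "(\<Sum>m\<in>I. g m n) \<le> (\<Sum>m\<in>I. G * (\<phi> m * e n)) + G * \<phi> n * (\<zeta> + H + 1)"
          using G \<phi>(1)[OF n] by (simp add: mult_left_mono)
      qed
      also have "(\<Sum>n\<in>I. \<Sum>m\<in>I. G * (\<phi> m * e n)) = G * (\<Sum>m\<in>I. \<phi> m) * (\<Sum>n\<in>I. e n)"
        by (subst sum.swap) (simp add: sum_distrib_left sum_distrib_right mult_ac)
      also have "\<dots> \<le> G * (\<Sum>m\<in>I. \<phi> m) * H"
        using G \<phi>(1)[OF I1] finI by (intro mult_left_mono H mult_nonneg_nonneg sum_nonneg) auto
      also have "(\<Sum>n\<in>I. G * \<phi> n * (\<zeta> + H + 1)) = G * (\<Sum>n\<in>I. \<phi> n) * (\<zeta> + H + 1)"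
        by (simp add: sum_distrib_left sum_distrib_right mult_ac)
      finally show ?thesis by (simp add: algebra_simps)
    qed
    finally have "(LINT x|M. (\<Sum>n\<in>I. indicator (E n) x - \<psi> n)\<^sup>2) \<le> B * (\<Sum>n\<in>I. \<phi> n)"
      by (simp add: B_def algebra_simps)
    then show ?thesis unfolding I_def[symmetric]
      by (subst nn_integral_eq_integral[OF intprod]) (auto intro: ennreal_leI)
  qed
  then show ?thesis using B that unfolding \<phi>_def by blast
qed

section \<open>Asymptotic independence of the targets\<close>

text \<open>The degree of the majorant for the earlier of two targets at distance \<open>j = n - m\<close>
  should be as large as possible subject to two bounds: a power of \<open>j\<close> (well below
  \<open>K ^ j\<close>), so that frequencies do not cancel, and a power of \<open>m\<close>, so that the sum of
  its coefficients is at most a power of \<open>log m\<close>. The excess \<open>1 / N\<close> then stays summable both over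
  \<open>j\<close> and over \<open>m\<close>. When \<open>j\<close> or \<open>m\<close> is small, only the constant polynomial,
  \<open>N = 1\<close>, is left.\<close>
lemma degree_choice:
  fixes K d :: real
  assumes K: "K > 1" and d: "d \<ge> 0"
  obtains c where "c > 0"
    "\<And>m j. m \<ge> 1 \<Longrightarrow> j \<ge> 1 \<Longrightarrow> \<exists>N\<ge>1. N \<le> m ^ 2 \<and> d * (real N ^ 3 - 1) \<le> K ^ j / 2 \<and>
       1 / real N \<le> c * (1 / real j ^ 2 + 1 / real m ^ 2)"
proof -
  have "(\<lambda>j. real j ^ 6 / K ^ j) \<longlonglongrightarrow> 0" using K by real_asymp
  then have "Bseq (\<lambda>j. real j ^ 6 / K ^ j)" by (intro convergent_imp_Bseq) (auto simp: convergent_def)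
  then obtain B where B: "B > 0" "\<And>j. norm (real j ^ 6 / K ^ j) \<le> B" by (auto elim: BseqE)
  \<comment> \<open>small enough that \<open>d * b * j ^ 6 \<le> K ^ j / 2\<close> for all \<open>j\<close>\<close>
  define b where "b = min 1 (1 / (2 * d * B + 1))"
  have pos: "2 * d * B + 1 > 0" using d B by (intro add_nonneg_pos mult_nonneg_nonneg) auto
  have b: "b > 0" "b \<le> 1" using pos by (auto simp: b_def)
  have bd: "d * b * B \<le> 1 / 2"
  proof -
    have "b * (2 * d * B + 1) \<le> 1 / (2 * d * B + 1) * (2 * d * B + 1)"
      using pos by (intro mult_right_mono) (auto simp: b_def)
    also have "\<dots> = 1" using pos by simp
    finally have "b * (2 * d * B + 1) \<le> 1" .
    then show ?thesis using b by (simp add: algebra_simps)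
  qed
  show ?thesis
  proof (rule that[of "2 / b"])
    show "2 / b > 0" using b by simp
    fix m j :: nat assume m: "m \<ge> 1" and j: "j \<ge> 1"
    define k where "k = min m j"
    have k: "k \<ge> 1" "k \<le> m" "k \<le> j" using m j by (auto simp: k_def)
    have inv_k: "1 / real k ^ 2 \<le> 1 / real j ^ 2 + 1 / real m ^ 2"
      by (cases "m \<le> j") (auto simp: k_def min_def)
    define t where "t = b * real k ^ 2"
    have t: "t > 0" using b k by (simp add: t_def)
    have tk: "t \<le> real k ^ 2" using b by (simp add: t_def mult_left_le_one_le)
    show "\<exists>N\<ge>1. N \<le> m ^ 2 \<and> d * (real N ^ 3 - 1) \<le> K ^ j / 2 \<and>
       1 / real N \<le> 2 / b * (1 / real j ^ 2 + 1 / real m ^ 2)"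
    proof (cases "t < 1")
      case True
      have "1 \<le> 2 / t" using True t by (simp add: field_simps)
      also have "2 / t = 2 / b * (1 / real k ^ 2)" by (simp add: t_def)
      also have "\<dots> \<le> 2 / b * (1 / real j ^ 2 + 1 / real m ^ 2)"
        using b by (intro mult_left_mono inv_k) auto
      finally show ?thesis using m K by (intro exI[of _ 1]) auto
    next
      case False
      define N where "N = nat \<lfloor>t\<rfloor>"
      have N: "real N = of_int \<lfloor>t\<rfloor>" using t by (simp add: N_def)
      have N1: "N \<ge> 1" using False by (simp add: N_def le_nat_iff)
      have Nt: "real N \<le> t" unfolding N by linarith
      have tN: "t < real N + 1" unfolding N by linarith
      have "real N \<le> real k ^ 2" using Nt tk by linarith
      also have "\<dots> \<le> real m ^ 2" using k by (intro power_mono) auto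
      finally have "real N \<le> real (m ^ 2)" by simp
      then have Nm: "N \<le> m ^ 2" by (simp only: of_nat_le_iff)
      have "1 / real N \<le> 2 / t" using tN N1 t by (simp add: field_simps)
      also have "2 / t = 2 / b * (1 / real k ^ 2)" by (simp add: t_def)
      also have "\<dots> \<le> 2 / b * (1 / real j ^ 2 + 1 / real m ^ 2)"
        using b by (intro mult_left_mono inv_k) auto
      finally have 1: "1 / real N \<le> 2 / b * (1 / real j ^ 2 + 1 / real m ^ 2)" .
      have "real N ^ 3 \<le> t ^ 3" using Nt by (intro power_mono) auto
      also have "\<dots> = b ^ 3 * real k ^ 6" by (simp add: t_def power_mult_distrib flip: power_mult)
      also have "\<dots> \<le> b * real j ^ 6"
      proof (intro mult_mono)
        show "b ^ 3 \<le> b" using b power_decreasing[of 1 3 b] by simp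
        show "real k ^ 6 \<le> real j ^ 6" using k by (intro power_mono) auto
      qed (use b in auto)
      also have "\<dots> \<le> b * (B * K ^ j)"
        using B(2)[of j] K b by (intro mult_left_mono) (auto simp: field_simps)
      finally have "d * real N ^ 3 \<le> d * (b * (B * K ^ j))" using d by (intro mult_left_mono)
      also have "\<dots> = d * b * B * K ^ j" by simp
      also have "\<dots> \<le> 1 / 2 * K ^ j" using bd K by (intro mult_right_mono) auto
      finally have "d * (real N ^ 3 - 1) \<le> K ^ j / 2" using d by (simp add: right_diff_distrib)
      then show ?thesis using N1 Nm 1 by blast
    qed
  qed
qed

text \<open>Coefficient sums contribute powers of logarithms, with \<open>k = 2 * CARD('d)\<close> for a pair
  of targets; they are absorbed into a small power of \<open>n\<close>.\<close>
lemma log_power_times_powr_bound: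
  fixes s q :: real and k :: nat
  assumes "q + 1 < s"
  obtains B where "B > 0"
    "\<And>n. n \<ge> 1 \<Longrightarrow> (6 + 6 * ln (real n)) ^ k * real n powr (- s) \<le> B * (real n powr (- q) / real n)"
proof -
  define \<delta> where "\<delta> = s - q - 1"
  have \<delta>: "\<delta> > 0" using assms by (simp add: \<delta>_def)
  have "(\<lambda>n. (6 + 6 * ln (real n)) ^ k * real n powr (- \<delta>)) \<longlonglongrightarrow> 0"
    using \<delta> by real_asymp
  then have "Bseq (\<lambda>n. (6 + 6 * ln (real n)) ^ k * real n powr (- \<delta>))"
    by (intro convergent_imp_Bseq) (auto simp: convergent_def)
  then obtain B where B: "B > 0" "\<And>n. norm ((6 + 6 * ln (real n)) ^ k * real n powr (- \<delta>)) \<le> B"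
    by (auto elim: BseqE)
  show ?thesis
  proof (rule that[OF B(1)])
    fix n :: nat assume n: "n \<ge> 1"
    have "(6 + 6 * ln (real n)) ^ k * real n powr (- s) =
        ((6 + 6 * ln (real n)) ^ k * real n powr (- \<delta>)) * (real n powr (- q) / real n)"
    proof -
      have "real n powr (- s) = real n powr (- \<delta>) * real n powr (- q) * real n powr (- 1)"
      proof -
        have "- s = - \<delta> + - q + - 1" by (simp add: \<delta>_def)
        then show ?thesis by (simp only: powr_add)
      qed
      then show ?thesis using n by (simp add: powr_minus_divide)
    qed
    also have "\<dots> \<le> B * (real n powr (- q) / real n)"
    proof (intro mult_right_mono)
      show "(6 + 6 * ln (real n)) ^ k * real n powr (- \<delta>) \<le> B"
        by (rule abs_le_D1[OF B(2)[unfolded real_norm_def]])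
    qed auto
    finally show "(6 + 6 * ln (real n)) ^ k * real n powr (- s) \<le> B * (real n powr (- q) / real n)" .
  qed
qed

text \<open>On the circle, the complement of an arc is an arc about the antipode.\<close>
lemma dist_int_half:
  assumes "dist_int a > \<rho>"
  shows "dist_int (a - 1 / 2) \<le> 1 / 2 - \<rho>"
proof -
  have "\<bar>a - of_int (round a)\<bar> \<le> 1 / 2" using of_int_round_abs_le[of a] by (simp add: abs_minus_commute)
  moreover have "\<bar>a - of_int (round a)\<bar> > \<rho>" using assms by (simp add: dist_int_eq_round)
  moreover have "dist_int (a - 1 / 2) \<le> \<bar>a - 1 / 2 - of_int (round a)\<bar>" by (rule dist_int_le)
  moreover have "dist_int (a - 1 / 2) \<le> \<bar>a - 1 / 2 - of_int (round a - 1)\<bar>" by (rule dist_int_le)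
  ultimately show ?thesis by (auto simp: abs_if split: if_splits)
qed

text \<open>Upper bounds for all boxes imply lower bounds. Deciding for each coordinate whether it lies
  in its arc or not cuts the space into \<open>2 ^ CARD('d)\<close> cells. The complement of an arc is an
  arc again, centred at the antipode with radius \<open>1 / 2 - \<rho> i\<close>, so each cell is contained
  in a set of the same kind as \<open>hit_set B y \<rho>\<close>. As the volumes of the cells add up to 1,
  as do their measures, no cell can fall short by more than the sum of the other excesses.\<close>
lemma hit_set_lower_bound:
  fixes M :: "(real^'d) measure" and B :: "real^'d^'d" and y :: "real^'d"
  assumes "prob_space M" and sets_M: "sets M = sets borel"
    and \<rho>: "\<And>i. 0 < \<rho> i \<and> \<rho> i < 1 / 2" and t: "t \<ge> 0"
    and upper: "\<And>y' \<rho>'. (\<And>i. 0 < \<rho>' i \<and> \<rho>' i < 1 / 2) \<Longrightarrow>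
      measure M (hit_set B y' \<rho>') \<le> (\<Prod>i\<in>UNIV. 2 * \<rho>' i) + t"
  shows "measure M (hit_set B y \<rho>) \<ge> (\<Prod>i\<in>UNIV. 2 * \<rho> i) - 2 ^ CARD('d) * t"
proof -
  interpret prob_space M by fact
  define cell where "cell T = {x. \<forall>i. dist_int ((B *v x) $ i - y $ i) \<le> \<rho> i \<longleftrightarrow> i \<in> T}" for T :: "'d set"
  define vol where "vol T = (\<Prod>i\<in>T. 2 * \<rho> i) * (\<Prod>i\<in>UNIV - T. 1 - 2 * \<rho> i)" for T :: "'d set"
  have cell_events: "cell T \<in> events" for T
  proof -
    have "cell T = (\<Inter>i. {x \<in> space borel. dist_int ((B *v x) $ i - y $ i) \<le> \<rho> i \<longleftrightarrow> i \<in> T})"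
      by (auto simp: cell_def)
    also have "\<dots> \<in> sets borel" by (intro sets.finite_INT) auto
    finally show ?thesis by (simp add: sets_M)
  qed
  have cell_le: "prob (cell T) \<le> vol T + t" for T
  proof -
    define \<rho>' where "\<rho>' i = (if i \<in> T then \<rho> i else 1 / 2 - \<rho> i)" for i
    define y' :: "real^'d" where "y' = (\<chi> i. if i \<in> T then y $ i else y $ i + 1 / 2)"
    have "cell T \<subseteq> hit_set B y' \<rho>'"
    proof
      fix x assume x: "x \<in> cell T"
      have "dist_int ((B *v x) $ i - y' $ i) \<le> \<rho>' i" for i
      proof -
        have mem: "dist_int ((B *v x) $ i - y $ i) \<le> \<rho> i \<longleftrightarrow> i \<in> T"
          using x unfolding cell_def by blast
        show ?thesis
        proof (cases "i \<in> T")
          case True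
          then show ?thesis using mem by (simp only: y'_def \<rho>'_def vec_lambda_beta if_True)
        next
          case False
          then have "dist_int ((B *v x) $ i - y $ i - 1 / 2) \<le> 1 / 2 - \<rho> i"
            using mem not_le by (intro dist_int_half) blast
          then show ?thesis
            using False by (simp only: y'_def \<rho>'_def vec_lambda_beta if_False diff_diff_eq)
        qed
      qed
      then show "x \<in> hit_set B y' \<rho>'" by (simp add: hit_set_def)
    qed
    then have "prob (cell T) \<le> prob (hit_set B y' \<rho>')"
      by (intro finite_measure_mono) (auto simp: sets_M hit_set_borel)
    also have "\<dots> \<le> (\<Prod>i\<in>UNIV. 2 * \<rho>' i) + t"
      by (rule upper) (use \<rho> in \<open>auto simp: \<rho>'_def\<close>)
    also have "(\<Prod>i\<in>UNIV. 2 * \<rho>' i) = vol T"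
    proof -
      have "(\<Prod>i\<in>UNIV. 2 * \<rho>' i) = (\<Prod>i\<in>UNIV - T. 2 * \<rho>' i) * (\<Prod>i\<in>T. 2 * \<rho>' i)"
        by (rule prod.subset_diff) auto
      also have "(\<Prod>i\<in>UNIV - T. 2 * \<rho>' i) = (\<Prod>i\<in>UNIV - T. 1 - 2 * \<rho> i)"
        by (intro prod.cong) (auto simp: \<rho>'_def)
      also have "(\<Prod>i\<in>T. 2 * \<rho>' i) = (\<Prod>i\<in>T. 2 * \<rho> i)"
        by (intro prod.cong) (auto simp: \<rho>'_def)
      finally show ?thesis by (simp add: vol_def mult.commute)
    qed
    finally show ?thesis .
  qed
  have total: "(\<Sum>T\<in>UNIV. vol T) = 1"
    using prod_add[of UNIV "\<lambda>i. 2 * \<rho> i" "\<lambda>i. 1 - 2 * \<rho> i"] by (simp add: vol_def)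
  have "1 = prob (\<Union>T. cell T)"
  proof -
    have "x \<in> cell {i. dist_int ((B *v x) $ i - y $ i) \<le> \<rho> i}" for x by (simp add: cell_def)
    then have "(\<Union>T. cell T) = UNIV" by blast
    moreover have "space M = UNIV" using sets_M sets_eq_imp_space_eq[of M borel] by simp
    ultimately show ?thesis using prob_space by simp
  qed
  also have "\<dots> = (\<Sum>T\<in>UNIV. prob (cell T))"
    using cell_events by (intro finite_measure_finite_Union) (auto simp: disjoint_family_on_def cell_def)
  also have "\<dots> = prob (cell UNIV) + (\<Sum>T\<in>UNIV - {UNIV}. prob (cell T))"
    by (rule sum.remove) auto
  also have "(\<Sum>T\<in>UNIV - {UNIV}. prob (cell T)) \<le> (\<Sum>T\<in>UNIV - {UNIV}. vol T + t)"
    by (intro sum_mono cell_le)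
  also have "\<dots> = (\<Sum>T\<in>UNIV - {UNIV}. vol T) + real (card (UNIV - {UNIV :: 'd set})) * t"
    by (simp add: sum.distrib)
  also have "(\<Sum>T\<in>UNIV - {UNIV}. vol T) = 1 - vol UNIV"
    using total sum.remove[of UNIV UNIV vol] by simp
  also have "real (card (UNIV - {UNIV :: 'd set})) * t \<le> 2 ^ CARD('d) * t"
  proof (intro mult_right_mono t)
    have "card (UNIV - {UNIV :: 'd set}) \<le> card (UNIV :: 'd set set)" by (intro card_mono) auto
    also have "\<dots> = 2 ^ CARD('d)" by (simp add: card_UNIV_set)
    finally have "real (card (UNIV - {UNIV :: 'd set})) \<le> real (2 ^ CARD('d))" by (simp only: of_nat_le_iff)
    then show "real (card (UNIV - {UNIV :: 'd set})) \<le> 2 ^ CARD('d)" by simp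
  qed
  finally have "prob (cell UNIV) \<ge> vol UNIV - 2 ^ CARD('d) * t" by simp
  moreover have "cell UNIV = hit_set B y \<rho>" by (simp add: cell_def hit_set_def)
  ultimately show ?thesis by (simp add: vol_def)
qed

context decaying_frequencies
begin

text \<open>The exponent of all error terms. It exceeds 1, so the errors are summable; it is at most 2,
  so it also covers the excess \<open>O(n powr (- 2))\<close> of the majorants; and \<open>rate + 1 < s\<close>, so
  that summing \<open>n powr (- s)\<close> over all \<open>m < n\<close> is affordable, logarithms included.\<close>
definition rate :: real where "rate = min 2 (s / 2)"

lemma rate: "1 < rate" "rate \<le> 2" "rate + 1 < s"
  using s by (auto simp: rate_def)

lemma inverse_square_le_rate:
  assumes "n \<ge> 1"
  shows "1 / real n ^ 2 \<le> real n powr (- rate)"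
proof -
  have "1 / real n ^ 2 = real n powr (- 2)"
    using assms by (simp add: powr_minus_divide)
  also have "\<dots> \<le> real n powr (- rate)" using assms rate by (intro powr_mono) auto
  finally show ?thesis .
qed

text \<open>For single targets, and for the later of two, the majorant has degree parameter
  \<open>n\<^sup>2\<close>, giving an excess \<open>O(n powr (- rate))\<close> at the price of a power of
  \<open>log n\<close>, which the decay \<open>n powr (- s)\<close> absorbs with \<open>1 / n\<close> to spare; for the
  earlier of two it is chosen by \<open>degree_choice\<close>. In the second bound the main term is the product
  of the two volumes, and the error depending on \<open>n - m\<close> is multiplied by the (slightly
  enlarged) volume of the later target, which is what makes close pairs harmless.\<close>
lemma measure_hit_set_asymptotics:
  obtains C where "C > 0"
    "\<And>n y \<rho>. n \<ge> 1 \<Longrightarrow> (\<And>i. 0 < \<rho> i \<and> \<rho> i < 1 / 2) \<Longrightarrow>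
      \<bar>prob (hit_set (A n) y \<rho>) - (\<Prod>i\<in>UNIV. 2 * \<rho> i)\<bar> \<le> C * real n powr (- rate)"
    "\<And>m n y y' \<rho> \<rho>'. 1 \<le> m \<Longrightarrow> m < n \<Longrightarrow> (\<And>i. 0 < \<rho> i \<and> \<rho> i < 1 / 2) \<Longrightarrow>
      (\<And>i. 0 < \<rho>' i \<and> \<rho>' i < 1 / 2) \<Longrightarrow>
      prob (hit_set (A m) y \<rho> \<inter> hit_set (A n) y' \<rho>') \<le>
        ((\<Prod>i\<in>UNIV. 2 * \<rho> i) + C * (1 / real (n - m) ^ 2 + real m powr (- rate)))
          * ((\<Prod>i\<in>UNIV. 2 * \<rho>' i) + C * real n powr (- rate))
        + C * real n powr (- rate) / real n"
proof -
  let ?d = "CARD('d)"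
  obtain c where c: "c > 0" "\<And>m j. m \<ge> 1 \<Longrightarrow> j \<ge> 1 \<Longrightarrow>
     \<exists>N\<ge>1. N \<le> m ^ 2 \<and> real ?d * (real N ^ 3 - 1) \<le> K ^ j / 2 \<and>
       1 / real N \<le> c * (1 / real j ^ 2 + 1 / real m ^ 2)"
    using degree_choice[OF K, of "real ?d"] by auto
  obtain B where B: "B > 0" "\<And>n. n \<ge> 1 \<Longrightarrow>
      (6 + 6 * ln (real n)) ^ (2 * ?d) * real n powr (- s) \<le> B * (real n powr (- rate) / real n)"
    using log_power_times_powr_bound[OF rate(3), of "2 * ?d"] by blast
  have log1: "1 \<le> 6 + 6 * ln (real n)" if "n \<ge> 1" for n using that by simp
  have single_log: "(6 + 6 * ln (real n)) ^ ?d * real n powr (- s) \<le> B * real n powr (- rate)" if n: "n \<ge> 1" for n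
  proof -
    have "(6 + 6 * ln (real n)) ^ ?d * real n powr (- s) \<le> (6 + 6 * ln (real n)) ^ (2 * ?d) * real n powr (- s)"
      using log1[OF n] by (intro mult_right_mono power_increasing) auto
    also have "\<dots> \<le> B * (real n powr (- rate) / real n)" by (rule B(2)[OF n])
    also have "\<dots> \<le> B * real n powr (- rate)"
      using n B(1) divide_left_mono[of 1 "real n" "real n powr (- rate)"] by (intro mult_left_mono) auto
    finally show ?thesis .
  qed
  have log_mono: "(6 + 3 * ln (real N)) ^ ?d \<le> (6 + 6 * ln (real n)) ^ ?d" if "N \<ge> 1" "N \<le> n ^ 2" for N n
  proof (rule power_mono)
    have "0 < N" "0 < n" using that by (auto intro: Nat.gr0I)
    then have "ln (real N) \<le> ln (real (n ^ 2))" using that by (subst ln_le_cancel_iff) (auto simp flip: of_nat_power)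
    then show "6 + 3 * ln (real N) \<le> 6 + 6 * ln (real n)" using \<open>0 < n\<close> by (simp add: ln_realpow)
    show "0 \<le> 6 + 3 * ln (real N)" using that by simp
  qed
  have prod_le: "(\<Prod>i\<in>UNIV. 2 * \<rho> i + 3 / real N) \<le> (\<Prod>i\<in>UNIV. 2 * \<rho> i) + 5 ^ ?d * (3 / real N)"
    if "\<And>i. 0 < \<rho> i \<and> \<rho> i < 1 / 2" "N \<ge> 1" for \<rho> :: "'d \<Rightarrow> real" and N
    using that by (intro prod_add_le) (auto simp: less_imp_le field_simps)
  define C1 where "C1 = 5 ^ ?d * 3 + B * D"
  have C1: "C1 > 0" using B D by (simp add: C1_def add_pos_pos)
  have upper: "prob (hit_set (A n) y \<rho>) \<le> (\<Prod>i\<in>UNIV. 2 * \<rho> i) + C1 * real n powr (- rate)"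
    if n: "n \<ge> 1" and \<rho>: "\<And>i. 0 < \<rho> i \<and> \<rho> i < 1 / 2" for n y \<rho>
  proof -
    have n2: "n ^ 2 \<ge> 1" using n by simp
    have "prob (hit_set (A n) y \<rho>) \<le>
      (\<Prod>i\<in>UNIV. 2 * \<rho> i + 3 / real (n ^ 2)) + (6 + 3 * ln (real (n ^ 2))) ^ ?d * (D * real n powr (- s))"
      by (rule measure_hit_set_le[OF n n2 \<rho>])
    also have "(\<Prod>i\<in>UNIV. 2 * \<rho> i + 3 / real (n ^ 2)) \<le> (\<Prod>i\<in>UNIV. 2 * \<rho> i) + 5 ^ ?d * (3 / real (n ^ 2))"
      by (rule prod_le[OF \<rho> n2])
    also have "(5::real) ^ ?d * (3 / real (n ^ 2)) = 5 ^ ?d * 3 * (1 / real n ^ 2)" by simp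
    also have "\<dots> \<le> 5 ^ ?d * 3 * real n powr (- rate)"
      by (intro mult_left_mono inverse_square_le_rate n) auto
    also have "(6 + 3 * ln (real (n ^ 2))) ^ ?d * (D * real n powr (- s)) \<le>
        (6 + 6 * ln (real n)) ^ ?d * (D * real n powr (- s))"
      using D by (intro mult_right_mono log_mono n2) auto
    also have "\<dots> = D * ((6 + 6 * ln (real n)) ^ ?d * real n powr (- s))" by simp
    also have "\<dots> \<le> D * (B * real n powr (- rate))"
      using D by (intro mult_left_mono single_log n) auto
    finally show ?thesis by (simp add: C1_def algebra_simps)
  qed
  define C where "C = 2 ^ ?d * C1 + 5 ^ ?d * 3 * c + C1"
  have C: "C > 0" "C \<ge> C1" "C \<ge> 2 ^ ?d * C1" "C \<ge> 5 ^ ?d * 3 * c + B * D" "C \<ge> B * D"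
    using C1 c(1) B(1) D by (auto simp: C_def C1_def add_pos_pos add_nonneg_nonneg)
  show ?thesis
  proof (rule that[OF C(1)])
    fix n :: nat and y :: "real^'d" and \<rho> :: "'d \<Rightarrow> real" assume n: "n \<ge> 1" and \<rho>: "\<And>i. 0 < \<rho> i \<and> \<rho> i < 1 / 2"
    have "prob (hit_set (A n) y \<rho>) \<ge> (\<Prod>i\<in>UNIV. 2 * \<rho> i) - 2 ^ ?d * (C1 * real n powr (- rate))"
      using C1 sets_M by (intro hit_set_lower_bound prob_space_axioms \<rho> upper n) auto
    moreover have "2 ^ ?d * C1 * real n powr (- rate) \<le> C * real n powr (- rate)"
      by (intro mult_right_mono C) auto
    moreover have "C1 * real n powr (- rate) \<le> C * real n powr (- rate)"
      by (intro mult_right_mono C) auto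
    ultimately show "\<bar>prob (hit_set (A n) y \<rho>) - (\<Prod>i\<in>UNIV. 2 * \<rho> i)\<bar> \<le> C * real n powr (- rate)"
      using upper[of n \<rho> y, OF n \<rho>] by (simp add: abs_le_iff mult.assoc)
  next
    fix m n :: nat and y y' :: "real^'d" and \<rho> \<rho>' :: "'d \<Rightarrow> real"
    assume mn: "1 \<le> m" "m < n" and \<rho>: "\<And>i. 0 < \<rho> i \<and> \<rho> i < 1 / 2"
      and \<rho>': "\<And>i. 0 < \<rho>' i \<and> \<rho>' i < 1 / 2"
    have n: "n \<ge> 1" and n2: "n ^ 2 \<ge> 1" using mn by auto
    define j where "j = 1 / real (n - m) ^ 2"
    obtain N where N: "N \<ge> 1" "N \<le> m ^ 2" "real ?d * (real N ^ 3 - 1) \<le> K ^ (n - m) / 2"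
       "1 / real N \<le> c * (j + 1 / real m ^ 2)"
      using c(2)[OF mn(1), of "n - m"] mn unfolding j_def by (metis Suc_leI One_nat_def zero_less_diff)
    define P where "P = (\<Prod>i\<in>UNIV. 2 * \<rho> i)"
    define P' where "P' = (\<Prod>i\<in>UNIV. 2 * \<rho>' i)"
    have P: "P \<ge> 0" "P' \<ge> 0"
      using \<rho> \<rho>' by (auto simp: P_def P'_def less_imp_le intro!: prod_nonneg)
    have j: "j \<ge> 0" by (simp add: j_def)
    let ?Q = "\<Prod>i\<in>UNIV. 2 * \<rho> i + 3 / real N" and ?Q' = "\<Prod>i\<in>UNIV. 2 * \<rho>' i + 3 / real (n ^ 2)"
    have "prob (hit_set (A m) y \<rho> \<inter> hit_set (A n) y' \<rho>') \<le>
      (?Q + (6 + 3 * ln (real N)) ^ ?d * (D * real m powr (- s))) * ?Q'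
      + (6 + 3 * ln (real N)) ^ ?d * (6 + 3 * ln (real (n ^ 2))) ^ ?d * (D * real n powr (- s))"
      by (rule measure_hit_set_Int_le[OF mn N(1) n2 N(3) \<rho> \<rho>'])
    also have "\<dots> \<le> (P + C * (j + real m powr (- rate))) * (P' + C * real n powr (- rate))
        + C * (real n powr (- rate) / real n)"
    proof (rule add_mono[OF mult_mono])
      have "?Q \<le> P + 5 ^ ?d * (3 / real N)"
        unfolding P_def by (rule prod_le[OF \<rho> N(1)])
      also have "5 ^ ?d * (3 / real N) = 5 ^ ?d * 3 * (1 / real N)" by simp
      also have "\<dots> \<le> 5 ^ ?d * 3 * (c * (j + real m powr (- rate)))"
      proof (intro mult_left_mono)
        have "c * (j + 1 / real m ^ 2) \<le> c * (j + real m powr (- rate))"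
          using c(1) inverse_square_le_rate[OF mn(1)] by (intro mult_left_mono add_left_mono) auto
        then show "1 / real N \<le> c * (j + real m powr (- rate))" using N(4) by linarith
      qed auto
      finally have Q: "?Q \<le> P + 5 ^ ?d * 3 * c * (j + real m powr (- rate))" by (simp add: mult_ac)
      have "(6 + 3 * ln (real N)) ^ ?d * (D * real m powr (- s)) \<le> (6 + 6 * ln (real m)) ^ ?d * (D * real m powr (- s))"
        using D by (intro mult_right_mono log_mono N) auto
      also have "\<dots> = D * ((6 + 6 * ln (real m)) ^ ?d * real m powr (- s))" by simp
      also have "\<dots> \<le> D * (B * real m powr (- rate))"
        using D by (intro mult_left_mono single_log mn) auto
      also have "\<dots> \<le> B * D * (j + real m powr (- rate))"
        using B(1) D j by (simp add: algebra_simps)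
      finally have "?Q + (6 + 3 * ln (real N)) ^ ?d * (D * real m powr (- s)) \<le>
          P + (5 ^ ?d * 3 * c + B * D) * (j + real m powr (- rate))"
        using Q by (simp add: algebra_simps)
      also have "\<dots> \<le> P + C * (j + real m powr (- rate))"
        using j by (intro add_left_mono mult_right_mono C) auto
      finally show "?Q + (6 + 3 * ln (real N)) ^ ?d * (D * real m powr (- s)) \<le> P + C * (j + real m powr (- rate))" .
      have "?Q' \<le> P' + 5 ^ ?d * (3 / real (n ^ 2))"
        unfolding P'_def by (rule prod_le[OF \<rho>' n2])
      also have "5 ^ ?d * (3 / real (n ^ 2)) = 5 ^ ?d * 3 * (1 / real n ^ 2)" by simp
      also have "\<dots> \<le> C * real n powr (- rate)"
        using inverse_square_le_rate[OF n] C(2) B(1) D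
        by (intro mult_mono) (auto simp: C1_def intro: order_trans[OF _ C(2)[unfolded C1_def]])
      finally show "?Q' \<le> P' + C * real n powr (- rate)" by simp
      have "(6 + 3 * ln (real N)) ^ ?d * (6 + 3 * ln (real (n ^ 2))) ^ ?d \<le>
          (6 + 6 * ln (real n)) ^ ?d * (6 + 6 * ln (real n)) ^ ?d"
      proof (intro mult_mono log_mono N n2)
        have "m ^ 2 \<le> n ^ 2" using mn by (intro power_mono) auto
        then show "N \<le> n ^ 2" using N(2) by linarith
      qed (use n in auto)
      also have "\<dots> = (6 + 6 * ln (real n)) ^ (2 * ?d)" by (simp add: mult_2 power_add)
      finally have "(6 + 3 * ln (real N)) ^ ?d * (6 + 3 * ln (real (n ^ 2))) ^ ?d * (D * real n powr (- s)) \<le>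
          (6 + 6 * ln (real n)) ^ (2 * ?d) * (D * real n powr (- s))"
        using D by (intro mult_right_mono) auto
      also have "\<dots> = D * ((6 + 6 * ln (real n)) ^ (2 * ?d) * real n powr (- s))" by simp
      also have "\<dots> \<le> D * (B * (real n powr (- rate) / real n))"
        using D by (intro mult_left_mono B n) auto
      also have "\<dots> = B * D * (real n powr (- rate) / real n)" by simp
      also have "\<dots> \<le> C * (real n powr (- rate) / real n)"
        by (intro mult_right_mono C) auto
      finally show "(6 + 3 * ln (real N)) ^ ?d * (6 + 3 * ln (real (n ^ 2))) ^ ?d * (D * real n powr (- s)) \<le>
          C * (real n powr (- rate) / real n)" .
      show "0 \<le> P + C * (j + real m powr (- rate))" using P C j by simp
      show "0 \<le> ?Q'" using \<rho>' by (intro prod_nonneg) (auto simp: less_imp_le)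
    qed
    finally show "prob (hit_set (A m) y \<rho> \<inter> hit_set (A n) y' \<rho>') \<le>
        ((\<Prod>i\<in>UNIV. 2 * \<rho> i) + C * (1 / real (n - m) ^ 2 + real m powr (- rate)))
          * ((\<Prod>i\<in>UNIV. 2 * \<rho>' i) + C * real n powr (- rate))
        + C * real n powr (- rate) / real n"
      by (simp add: P_def P'_def j_def)
  qed
qed

end

section \<open>Counting hits\<close>

lemma hit_count_eq_sum:
  "real (hit_count A y r x N) = (\<Sum>n=1..N. indicator (hit_set (A n) y (\<lambda>i. r i n)) x)"
proof -
  have "hit_count A y r x N = card {n \<in> {1..N}. x \<in> hit_set (A n) y (\<lambda>i. r i n)}"
    by (simp add: hit_count_def mem_mod1_target_box_iff hit_set_def)
  also have "real \<dots> = (\<Sum>n=1..N. if x \<in> hit_set (A n) y (\<lambda>i. r i n) then 1 else 0)"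
    by (simp flip: sum.inter_filter)
  finally show ?thesis by (simp add: indicator_def of_bool_def)
qed

lemma Psi_eq_sum: "Psi r N = (\<Sum>n=1..N. \<Prod>i\<in>UNIV. 2 * r i n)"
  by (simp add: Psi_def prod.distrib)

text \<open>The clock \<open>b\<close> exceeds the expected count \<open>a\<close> by at most a constant, and \<open>a\<close> is
  bounded away from 0, so the error in terms of \<open>b\<close> with exponent 1/2 is majorised by the
  error in terms of \<open>a\<close> with any exponent \<open>\<delta> \<ge> 1 / 2\<close>.\<close>
lemma error_term_comparison:
  fixes p H \<delta> \<epsilon> :: real
  assumes p: "p > 0" and H: "H \<ge> 0" and \<delta>: "\<delta> \<ge> 1 / 2" and \<epsilon>: "\<epsilon> > 0"
  obtains C where "C \<ge> 0"
    "\<And>a b. p \<le> a \<Longrightarrow> 0 \<le> b \<Longrightarrow> b \<le> a + H \<Longrightarrow> sqrt (b + 1) * ln (b + 2) powr (2 + \<epsilon>) \<le>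
       C * (a powr \<delta> * ln (a + 2) powr (2 + \<epsilon>))"
proof -
  define \<kappa> where "\<kappa> = 1 + (H + 1) / p"
  define \<beta> where "\<beta> = 1 + ln (1 + H) / ln 2"
  have \<kappa>: "\<kappa> > 0" using p H by (auto simp: \<kappa>_def intro!: add_pos_nonneg)
  have \<beta>: "\<beta> \<ge> 1" using H by (simp add: \<beta>_def)
  show ?thesis
  proof (rule that[of "sqrt \<kappa> * p powr (1 / 2 - \<delta>) * \<beta> powr (2 + \<epsilon>)"])
    show "sqrt \<kappa> * p powr (1 / 2 - \<delta>) * \<beta> powr (2 + \<epsilon>) \<ge> 0" using \<kappa> by simp
    fix a b :: real assume a: "p \<le> a" and b: "0 \<le> b" "b \<le> a + H"
    have a0: "a > 0" using p a by simp
    have "H + 1 \<le> (H + 1) / p * a"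
    proof -
      have "(H + 1) * 1 \<le> (H + 1) * (a / p)" using a p H by (intro mult_left_mono) auto
      then show ?thesis by simp
    qed
    then have "b + 1 \<le> \<kappa> * a" using b by (simp add: \<kappa>_def distrib_right)
    then have "sqrt (b + 1) \<le> sqrt (\<kappa> * a)" by (rule real_sqrt_le_mono)
    also have "\<dots> = sqrt \<kappa> * (a powr (1 / 2 - \<delta>) * a powr \<delta>)"
    proof -
      have "a powr (1 / 2 - \<delta>) * a powr \<delta> = sqrt a"
        using a0 by (simp add: powr_half_sqrt flip: powr_add)
      then show ?thesis by (simp add: real_sqrt_mult)
    qed
    also have "\<dots> \<le> sqrt \<kappa> * (p powr (1 / 2 - \<delta>) * a powr \<delta>)"
      using p a \<delta> \<kappa> by (intro mult_left_mono mult_right_mono powr_mono2') auto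
    finally have 1: "sqrt (b + 1) \<le> sqrt \<kappa> * p powr (1 / 2 - \<delta>) * a powr \<delta>" by (simp add: mult.assoc)
    have "ln (b + 2) \<le> ln ((a + 2) * (1 + H))"
    proof -
      have "b + 2 \<le> (a + 2) * (1 + H)"
      proof -
        have "a * H \<ge> 0" using a0 H by simp
        moreover have "(a + 2) * (1 + H) = a + 2 + a * H + 2 * H" by (simp add: algebra_simps)
        ultimately show ?thesis using b H by linarith
      qed
      then show ?thesis using b by simp
    qed
    also have "\<dots> = ln (a + 2) + ln 2 * (ln (1 + H) / ln 2)" using a0 H by (simp add: ln_mult)
    also have "\<dots> \<le> ln (a + 2) + ln (a + 2) * (ln (1 + H) / ln 2)"
      using a0 H by (intro add_left_mono mult_right_mono) auto
    also have "\<dots> = \<beta> * ln (a + 2)" by (simp add: \<beta>_def algebra_simps)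
    finally have "ln (b + 2) powr (2 + \<epsilon>) \<le> (\<beta> * ln (a + 2)) powr (2 + \<epsilon>)"
      using b \<epsilon> by (intro powr_mono2) auto
    also have "\<dots> = \<beta> powr (2 + \<epsilon>) * ln (a + 2) powr (2 + \<epsilon>)" by (rule powr_mult)
    finally have 2: "ln (b + 2) powr (2 + \<epsilon>) \<le> \<beta> powr (2 + \<epsilon>) * ln (a + 2) powr (2 + \<epsilon>)" .
    have "sqrt (b + 1) * ln (b + 2) powr (2 + \<epsilon>) \<le>
        (sqrt \<kappa> * p powr (1 / 2 - \<delta>) * a powr \<delta>) * (\<beta> powr (2 + \<epsilon>) * ln (a + 2) powr (2 + \<epsilon>))"
      using 1 2 \<kappa> by (intro mult_mono) auto
    then show "sqrt (b + 1) * ln (b + 2) powr (2 + \<epsilon>) \<le>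
       sqrt \<kappa> * p powr (1 / 2 - \<delta>) * \<beta> powr (2 + \<epsilon>) * (a powr \<delta> * ln (a + 2) powr (2 + \<epsilon>))"
      by (simp add: mult_ac)
  qed
qed

context decaying_frequencies
begin

text \<open>The clock \<open>\<Phi> N\<close> is \<open>Psi r N\<close> increased by a convergent series. If it is
  unbounded, the second-moment criterion applies. If it is bounded, the measures of the targets
  are summable, almost every point hits only finitely many of them by Borel--Cantelli, and both
  terms of the difference are bounded while the right-hand side is bounded below.\<close>
lemma hit_count_asymptotics:
  fixes y :: "real^'d" and r :: "'d \<Rightarrow> nat \<Rightarrow> real"
  assumes r: "\<And>i n. n \<ge> 1 \<Longrightarrow> 0 < r i n \<and> r i n < 1 / 2"
    and \<delta>: "\<delta> \<ge> 1 / 2" and \<epsilon>: "\<epsilon> > 0"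
  shows "AE x in M. \<exists>C. \<forall>N\<ge>1. \<bar>real (hit_count A y r x N) - Psi r N\<bar> \<le>
    C * (Psi r N powr \<delta> * ln (Psi r N + 2) powr (2 + \<epsilon>))"
proof -
  define E where "E n = hit_set (A n) y (\<lambda>i. r i n)" for n
  define \<psi> where "\<psi> n = (\<Prod>i\<in>UNIV. 2 * r i n)" for n
  define e where "e n = real n powr (- rate)" for n
  define \<Phi> where "\<Phi> N = (\<Sum>n=1..N. \<psi> n + e n)" for N
  define H where "H = (\<Sum>n. e n)"
  define p where "p = Psi r 1"
  have E [measurable]: "E n \<in> events" for n by (simp add: E_def sets_M)
  have \<psi>: "0 < \<psi> n \<and> \<psi> n \<le> 1" if "n \<ge> 1" for n
  proof -
    have "0 < 2 * r i n \<and> 2 * r i n \<le> 1" for i using r[OF that, of i] by auto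
    then show ?thesis unfolding \<psi>_def by (auto intro!: prod_pos prod_le_1 simp: less_imp_le)
  qed
  have e: "e n \<ge> 0" "summable e" for n
    unfolding e_def using rate by (simp_all add: summable_real_powr_iff)
  have e1: "e n \<le> 1" if "n \<ge> 1" for n
    unfolding e_def using that rate powr_mono[of "- rate" 0 "real n"] by simp
  have Psi: "Psi r N = (\<Sum>n=1..N. \<psi> n)" for N by (simp add: Psi_eq_sum \<psi>_def)
  have H: "H \<ge> 0" "sum e {1..N} \<le> H" for N
    using e by (auto simp: H_def intro!: suminf_nonneg sum_le_suminf)
  have \<Phi>_Psi: "Psi r N \<le> \<Phi> N" "\<Phi> N \<le> Psi r N + H" for N
    using H(2)[of N] e by (simp_all add: \<Phi>_def Psi sum.distrib sum_nonneg)
  have p: "p > 0" using \<psi>[of 1] by (simp add: p_def Psi)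
  have Psi_ge: "p \<le> Psi r N" if "N \<ge> 1" for N
    unfolding p_def Psi using that \<psi> by (intro sum_mono2) (auto intro: less_imp_le)
  have diff: "real (hit_count A y r x N) - Psi r N = (\<Sum>n=1..N. indicator (E n) x - \<psi> n)" for x N
    by (simp add: hit_count_eq_sum Psi E_def sum_subtractf)
  obtain C where C: "C > 0"
    "\<And>n y \<rho>. n \<ge> 1 \<Longrightarrow> (\<And>i. 0 < \<rho> i \<and> \<rho> i < 1 / 2) \<Longrightarrow>
      \<bar>prob (hit_set (A n) y \<rho>) - (\<Prod>i\<in>UNIV. 2 * \<rho> i)\<bar> \<le> C * real n powr (- rate)"
    "\<And>m n y y' \<rho> \<rho>'. 1 \<le> m \<Longrightarrow> m < n \<Longrightarrow> (\<And>i. 0 < \<rho> i \<and> \<rho> i < 1 / 2) \<Longrightarrow>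
      (\<And>i. 0 < \<rho>' i \<and> \<rho>' i < 1 / 2) \<Longrightarrow>
      prob (hit_set (A m) y \<rho> \<inter> hit_set (A n) y' \<rho>') \<le>
        ((\<Prod>i\<in>UNIV. 2 * \<rho> i) + C * (1 / real (n - m) ^ 2 + real m powr (- rate)))
          * ((\<Prod>i\<in>UNIV. 2 * \<rho>' i) + C * real n powr (- rate))
        + C * real n powr (- rate) / real n"
    using measure_hit_set_asymptotics by metis
  have single: "\<bar>prob (E n) - \<psi> n\<bar> \<le> C * e n" if "n \<ge> 1" for n
    unfolding E_def \<psi>_def e_def by (rule C(2)[OF that r[OF that]])
  have pair: "prob (E m \<inter> E n) \<le>
      (\<psi> m + C * (1 / real (n - m) ^ 2 + e m)) * (\<psi> n + C * e n) + C * e n / real n"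
    if mn: "1 \<le> m" "m < n" for m n
  proof -
    have n: "n \<ge> 1" using mn by simp
    show ?thesis unfolding E_def \<psi>_def e_def by (rule C(3)[OF mn r[OF mn(1)] r[OF n]])
  qed
  show ?thesis
  proof (cases "\<forall>v. \<exists>n. \<Phi> n \<ge> v")
    case True
    obtain B where B: "B \<ge> 0" "\<And>a b. (\<integral>\<^sup>+x. ennreal ((\<Sum>n\<in>{a<..b}. indicator (E n) x - \<psi> n)\<^sup>2) \<partial>M)
       \<le> ennreal (B * (\<Sum>n\<in>{a<..b}. \<psi> n + e n))"
    proof (rule variance_bound_of_quasi_independence[where E = E and \<psi> = \<psi> and e = e and C = C])
      show "0 \<le> \<psi> n \<and> \<psi> n \<le> 1" if "n \<ge> 1" for n using \<psi>[OF that] by simp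
    qed (use E e C(1) single pair that in auto)
    have "AE x in M. \<exists>C\<ge>0. \<forall>N\<ge>1. \<bar>\<Sum>n=1..N. indicator (E n) x - \<psi> n\<bar> \<le>
        C * (sqrt (\<Phi> N + 1) * ln (\<Phi> N + 2) powr (2 + \<epsilon>))"
      unfolding \<Phi>_def
    proof (rule strong_law_of_variance_bound[where c = 2 and B = B])
      show "0 \<le> \<psi> n \<and> \<psi> n \<le> \<psi> n + e n \<and> \<psi> n + e n \<le> 2" if "n \<ge> 1" for n
        using \<psi>[OF that] e(1)[of n] e1[OF that] by auto
      show "\<exists>n. v \<le> (\<Sum>n=1..n. \<psi> n + e n)" for v using True unfolding \<Phi>_def by blast
    qed (use B \<epsilon> in auto)
    moreover obtain C' where C': "C' \<ge> 0"
      "\<And>a b. p \<le> a \<Longrightarrow> 0 \<le> b \<Longrightarrow> b \<le> a + H \<Longrightarrow> sqrt (b + 1) * ln (b + 2) powr (2 + \<epsilon>) \<le>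
       C' * (a powr \<delta> * ln (a + 2) powr (2 + \<epsilon>))"
      using error_term_comparison[OF p H(1) \<delta> \<epsilon>] by blast
    ultimately show ?thesis
    proof (elim AE_mp, intro AE_I2 impI)
      fix x assume "\<exists>C\<ge>0. \<forall>N\<ge>1. \<bar>\<Sum>n=1..N. indicator (E n) x - \<psi> n\<bar> \<le>
        C * (sqrt (\<Phi> N + 1) * ln (\<Phi> N + 2) powr (2 + \<epsilon>))"
      then obtain C'' where C'': "C'' \<ge> 0" "\<And>N. N \<ge> 1 \<Longrightarrow> \<bar>\<Sum>n=1..N. indicator (E n) x - \<psi> n\<bar> \<le>
        C'' * (sqrt (\<Phi> N + 1) * ln (\<Phi> N + 2) powr (2 + \<epsilon>))" by blast
      show "\<exists>C. \<forall>N\<ge>1. \<bar>real (hit_count A y r x N) - Psi r N\<bar> \<le>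
          C * (Psi r N powr \<delta> * ln (Psi r N + 2) powr (2 + \<epsilon>))"
      proof (intro exI[of _ "C'' * C'"] allI impI)
        fix N :: nat assume N: "N \<ge> 1"
        have "\<Phi> N \<ge> 0" using Psi_ge[OF N] \<Phi>_Psi(1)[of N] p by linarith
        then have "sqrt (\<Phi> N + 1) * ln (\<Phi> N + 2) powr (2 + \<epsilon>) \<le>
            C' * (Psi r N powr \<delta> * ln (Psi r N + 2) powr (2 + \<epsilon>))"
          by (intro C' Psi_ge[OF N] \<Phi>_Psi)
        then have "C'' * (sqrt (\<Phi> N + 1) * ln (\<Phi> N + 2) powr (2 + \<epsilon>)) \<le>
            C'' * (C' * (Psi r N powr \<delta> * ln (Psi r N + 2) powr (2 + \<epsilon>)))"
          using C''(1) by (rule mult_left_mono)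
        then show "\<bar>real (hit_count A y r x N) - Psi r N\<bar> \<le>
            C'' * C' * (Psi r N powr \<delta> * ln (Psi r N + 2) powr (2 + \<epsilon>))"
          unfolding diff using C''(2)[OF N] by (simp add: mult.assoc)
      qed
    qed
  next
    case False
    then obtain v where v: "\<And>n. \<Phi> n < v" by (auto simp: not_le)
    have "summable (\<lambda>n. prob (E (Suc n)))"
    proof (rule summableI_nonneg_bounded)
      show "0 \<le> prob (E (Suc n))" for n by simp
      fix N
      have "(\<Sum>n<N. prob (E (Suc n))) = (\<Sum>n=1..N. prob (E n))"
        by (rule sum.reindex_bij_witness[of _ "\<lambda>n. n - 1" Suc]) auto
      also have "\<dots> \<le> (\<Sum>n=1..N. \<psi> n + C * e n)"
      proof (rule sum_mono)
        fix n assume "n \<in> {1..N}"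
        then show "prob (E n) \<le> \<psi> n + C * e n" using single[of n] by auto
      qed
      also have "\<dots> = Psi r N + C * (\<Sum>n=1..N. e n)" by (simp add: Psi sum.distrib sum_distrib_left)
      also have "\<dots> \<le> v + C * H"
        using C(1) H(2)[of N] v[of N] \<Phi>_Psi(1)[of N] by (intro add_mono mult_left_mono) auto
      finally show "(\<Sum>n<N. prob (E (Suc n))) \<le> v + C * H" .
    qed
    then have "AE x in M. eventually (\<lambda>n. x \<in> space M - E (Suc n)) sequentially"
      by (intro borel_cantelli_AE1) (auto simp: emeasure_eq_measure)
    then show ?thesis
    proof (rule AE_mp, intro AE_I2 impI)
      fix x assume "eventually (\<lambda>n. x \<in> space M - E (Suc n)) sequentially"
      then obtain n0 where n0: "\<And>n. n \<ge> n0 \<Longrightarrow> x \<notin> E (Suc n)"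
        by (auto simp: eventually_sequentially)
      define t where "t = p powr \<delta> * ln 2 powr (2 + \<epsilon>)"
      have t: "t > 0" using p by (simp add: t_def)
      show "\<exists>C. \<forall>N\<ge>1. \<bar>real (hit_count A y r x N) - Psi r N\<bar> \<le>
          C * (Psi r N powr \<delta> * ln (Psi r N + 2) powr (2 + \<epsilon>))"
      proof (intro exI[of _ "(real n0 + v) / t"] allI impI)
        fix N :: nat assume N: "N \<ge> 1"
        have "real (hit_count A y r x N) = (\<Sum>n=1..N. indicator (E n) x)"
          by (simp add: hit_count_eq_sum E_def)
        also have "\<dots> \<le> (\<Sum>n=1..N. of_bool (n \<le> n0))"
        proof (rule sum_mono)
          fix n assume "n \<in> {1..N}"
          then show "indicator (E n) x \<le> (of_bool (n \<le> n0) :: real)"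
            using n0[of "n - 1"] by (cases "n \<le> n0") (auto simp: indicator_def)
        qed
        also have "\<dots> \<le> real n0"
        proof -
          have "(\<Sum>n=1..N. of_bool (n \<le> n0)) = real (card {n \<in> {1..N}. n \<le> n0})"
            by (simp add: of_bool_def flip: sum.inter_filter)
          also have "card {n \<in> {1..N}. n \<le> n0} \<le> card {1..n0}" by (intro card_mono) auto
          finally show ?thesis by simp
        qed
        finally have hc: "real (hit_count A y r x N) \<le> real n0" .
        have Psi_v: "0 \<le> Psi r N" "Psi r N \<le> v"
          using Psi_ge[OF N] p \<Phi>_Psi(1)[of N] v[of N] by linarith+
        have "\<bar>real (hit_count A y r x N) - Psi r N\<bar> \<le> (real n0 + v) / t * t"
          using hc Psi_v t by (simp add: abs_le_iff)
        also have "\<dots> \<le> (real n0 + v) / t * (Psi r N powr \<delta> * ln (Psi r N + 2) powr (2 + \<epsilon>))"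
          unfolding t_def[of] using Psi_v t p Psi_ge[OF N] \<delta> \<epsilon>
          by (intro mult_left_mono mult_mono powr_mono2) (auto simp: t_def)
        finally show "\<bar>real (hit_count A y r x N) - Psi r N\<bar> \<le>
          (real n0 + v) / t * (Psi r N powr \<delta> * ln (Psi r N + 2) powr (2 + \<epsilon>))" .
      qed
    qed
  qed
qed

end

theorem theorem1p8:
  fixes M :: "(real^'d) measure"
    and E :: "(real^'d) set"
    and A :: "nat \<Rightarrow> real^'d^'d"
    and y :: "real^'d"
    and r :: "'d \<Rightarrow> nat \<Rightarrow> real"
    and K s :: real
  assumes "prob_space M" and "sets M = sets borel"
    and "E \<subseteq> unit_cube" and "msupport M \<subseteq> E"
    and "\<And>n. n \<ge> 1 \<Longrightarrow> expanding_integral (A n)"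
    and "K > 1"
    and "\<And>n. n \<ge> 1 \<Longrightarrow> smallest_singular_value (A (n + 1) ** matrix_inv (A n)) \<ge> K"
    and "s > real CARD('d) + 1"
    and "(\<lambda>t. norm (fourier M t)) \<in> O[filtercomap infnorm at_top](\<lambda>t. ln (infnorm t) powr (- s))"
    and "y \<in> unit_cube"
    and "\<And>i n. n \<ge> 1 \<Longrightarrow> 0 < r i n \<and> r i n < 1 / 2"
  shows "\<forall>\<epsilon>>0. AE x in M. x \<in> E \<longrightarrow>
    (\<exists>C. \<forall>N\<ge>1. \<bar>real (hit_count A y r x N) - Psi r N\<bar>
       \<le> C * (Psi r N powr (real CARD('d) / (real CARD('d) + 1)) * ln (Psi r N + 2) powr (2 + \<epsilon>)))"
proof (intro allI impI)
  fix \<epsilon> :: real assume \<epsilon>: "\<epsilon> > 0"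
  have d: "real CARD('d) \<ge> 1" by (simp add: Suc_leI)
  have s: "s > 2" using d assms(8) by linarith
  have inv: "invertible (A n)" if "n \<ge> 1" for n
    using assms(5)[OF that] by (rule expanding_integral_invertible)
  have lac: "expands K (A (n + 1) ** matrix_inv (A n))" if "n \<ge> 1" for n
    using assms(7)[OF that] by (rule expands_smallest_singular_value)
  obtain c where c: "c > 0"
    "\<And>n w. n \<ge> 1 \<Longrightarrow> norm w \<ge> 1 \<Longrightarrow> norm (w v* A n) \<ge> c * K ^ n"
    "\<And>m n k l. 1 \<le> m \<Longrightarrow> m < n \<Longrightarrow> norm k \<le> K ^ (n - m) / 2 \<Longrightarrow> norm l \<ge> 1 \<Longrightarrow>
       norm (k v* A m + l v* A n) \<ge> c * K ^ n"
    using frequency_growth[of A K, OF inv assms(6) lac] by blast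
  have s0: "s > 0" using s by simp
  obtain D where D: "D > 0"
    "\<And>n t. n \<ge> 1 \<Longrightarrow> norm t \<ge> c * K ^ n \<Longrightarrow> norm (fourier M t) \<le> D * real n powr (- s)"
    using fourier_decay_exponential_frequency[OF assms(1,6) c(1) s0 assms(9)] by blast
  interpret decaying_frequencies M A K s D
  proof (intro decaying_frequencies.intro decaying_frequencies_axioms.intro)
    show "norm (fourier M (- (l v* A n))) \<le> D * real n powr (- s)" if "n \<ge> 1" "norm l \<ge> 1" for n l
      using c(2)[OF that] that by (intro D(2)) auto
    show "norm (fourier M (- (k v* A m + l v* A n))) \<le> D * real n powr (- s)"
      if mn: "1 \<le> m" "m < n" "norm k \<le> K ^ (n - m) / 2" "norm l \<ge> 1" for m n k l
      using c(3)[OF mn] mn by (intro D(2)) (auto simp only: norm_minus_cancel)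
  qed (use assms s D in auto)
  have "real CARD('d) / (real CARD('d) + 1) \<ge> 1 / 2" using d by (simp add: field_simps)
  from hit_count_asymptotics[where y = y, OF assms(11) this \<epsilon>]
  show "AE x in M. x \<in> E \<longrightarrow>
    (\<exists>C. \<forall>N\<ge>1. \<bar>real (hit_count A y r x N) - Psi r N\<bar>
       \<le> C * (Psi r N powr (real CARD('d) / (real CARD('d) + 1)) * ln (Psi r N + 2) powr (2 + \<epsilon>)))"
    by (rule AE_mp) (auto intro!: AE_I2)
qed

end
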